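(* Let $G$ be a connected finite simple graph on the vertex set $[n]=\{1,\dots,n\}$ such that any two induced odd cycles of $G$ have distance at most one, that is, either there is an edge of $G$ between a vertex of one cycle and a vertex of the other, or the two cycles share a common vertex. Let $S=K[x_1,\dots,x_n]$ be the polynomial ring over a field $K$ and $I(G)\subset S$ the edge ideal of $G$. Then $$\mathrm{HS}_{n-1}(I(G)^{k+1})=I(G)\cdot\mathrm{HS}_{n-1}(I(G)^k)$$ for all $k\gg0$.
   Context: The edge ideal $I(G)\subset S$ is the monomial ideal generated by the monomials $x_ix_j$ for which $\{i,j\}$ is an edge of $G$. For $\mathbf a=(a_1,\dots,a_n)\in\mathbb Z_{\ge0}^n$ write $\mathbf x^{\mathbf a}=x_1^{a_1}\cdots x_n^{a_n}$. For a monomial ideal $J\subset S$, the $i$th homological shift ideal of $J$ is the monomial ideal $$\mathrm{HS}_i(J)=(\mathbf x^{\mathbf a}\ :\ \mathrm{Tor}^S_i(K,J)_{\mathbf a}\neq 0),$$ where $\mathrm{Tor}^S_i(K,J)$ carries its natural $\mathbb Z^n$-grading and $K=S/(x_1,\dots,x_n)$. *)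

theory Defs
  imports Complex_Main "HOL-Library.Poly_Mapping" "HOL-Library.Cardinality"
begin

text \<open>
  The vertex set \<open>[n]\<close> is a finite type \<open>'n\<close> with \<open>n = CARD('n)\<close>, and
  \<open>S = K[x\<^sub>v : v \<in> 'n]\<close> is the type \<open>('n, 'k) mpoly\<close> of finitely supported functions
  from exponent vectors to \<open>K = 'k\<close>, with the convolution product.
\<close>

type_synonym ('n, 'k) mpoly = "('n \<Rightarrow>\<^sub>0 nat) \<Rightarrow>\<^sub>0 'k"

definition xmonom :: "('n \<Rightarrow>\<^sub>0 nat) \<Rightarrow> ('n, 'k::comm_ring_1) mpoly" where
  "xmonom a = Poly_Mapping.single a 1"

definition xvar :: "'n \<Rightarrow> ('n, 'k::comm_ring_1) mpoly" where
  "xvar v = xmonom (Poly_Mapping.single v 1)"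


section \<open>Ideals\<close>

text \<open>The ring is regarded as a module over itself.\<close>

definition ideal_gen :: "'a::comm_ring_1 set \<Rightarrow> 'a set" where
  "ideal_gen A = module.span (*) A"

definition ideal_mult :: "'a::comm_ring_1 set \<Rightarrow> 'a set \<Rightarrow> 'a set" where
  "ideal_mult I J = ideal_gen {f * g | f g. f \<in> I \<and> g \<in> J}"

primrec ideal_power :: "'a::comm_ring_1 set \<Rightarrow> nat \<Rightarrow> 'a set" where
  "ideal_power I 0 = UNIV"
| "ideal_power I (Suc k) = ideal_mult I (ideal_power I k)"

lemma module_self: "module ((*) :: 'a::comm_ring_1 \<Rightarrow> 'a \<Rightarrow> 'a)"
  by unfold_locales (simp_all add: algebra_simps)


section \<open>Multigraded free resolutions and Tor\<close>

text \<open>Homogeneous of degree \<open>c \<in> \<int>\<^sup>n\<close>; the zero polynomial is homogeneous of every degree.\<close>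

definition mhomogeneous :: "('n \<Rightarrow> int) \<Rightarrow> ('n, 'k::zero) mpoly \<Rightarrow> bool" where
  "mhomogeneous c p \<longleftrightarrow>
     (\<forall>m \<in> Poly_Mapping.keys p. \<forall>v. int (Poly_Mapping.lookup m v) = c v)"

text \<open>All free modules are submodules of the free module on a countable basis, which loses
  nothing, since the residue field has a resolution by free modules of finite rank.\<close>

type_synonym ('n, 'k) free_mod = "nat \<Rightarrow>\<^sub>0 ('n, 'k) mpoly"

definition smult_free ::
  "('n, 'k::comm_ring_1) mpoly \<Rightarrow> ('n, 'k) free_mod \<Rightarrow> ('n, 'k) free_mod" where
  "smult_free r z = Poly_Mapping.map ((*) r) z"

text \<open>The action of \<open>S\<close> on \<open>K = S/(x\<^sub>1,\<dots>,x\<^sub>n)\<close>: a polynomial acts through its constant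
  coefficient.\<close>

definition smult_residue :: "('n, 'k::comm_ring_1) mpoly \<Rightarrow> 'k \<Rightarrow> 'k" where
  "smult_residue r c = Poly_Mapping.lookup r 0 * c"

lemma lookup_smult_free:
  "Poly_Mapping.lookup (smult_free r z) b = r * Poly_Mapping.lookup z b"
  by (simp add: smult_free_def Poly_Mapping.map.rep_eq when_def)

lemma module_smult_free:
  "module (smult_free :: ('n, 'k::comm_ring_1) mpoly \<Rightarrow> ('n, 'k) free_mod \<Rightarrow> ('n, 'k) free_mod)"
  by unfold_locales
    (auto intro!: poly_mapping_eqI simp: lookup_smult_free lookup_add algebra_simps)

lemma lookup_mult_zero:
  fixes r s :: "('n, 'k::comm_ring_1) mpoly"
  shows "Poly_Mapping.lookup (r * s) 0 = Poly_Mapping.lookup r 0 * Poly_Mapping.lookup s 0"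
proof -
  have zero: "l + q = 0 \<longleftrightarrow> l = 0 \<and> q = 0" for l q :: "'n \<Rightarrow>\<^sub>0 nat"
    by (auto simp: poly_mapping_eq_iff lookup_add fun_eq_iff)
  have inner: "(\<Sum>q. Poly_Mapping.lookup s q when l + q = 0)
        = (Poly_Mapping.lookup s 0 when l = 0)" for l :: "'n \<Rightarrow>\<^sub>0 nat"
    by (cases "l = 0") (simp_all add: zero)
  have outer: "Poly_Mapping.lookup r l * (Poly_Mapping.lookup s 0 when l = 0)
        = (Poly_Mapping.lookup r l * Poly_Mapping.lookup s 0 when l = 0)" for l
    by (simp add: when_def)
  show ?thesis
    by (simp add: times_poly_mapping.rep_eq prod_fun_def inner outer eq_commute[of 0])
qed

lemma module_smult_residue:
  "module (smult_residue :: ('n, 'k::comm_ring_1) mpoly \<Rightarrow> 'k \<Rightarrow> 'k)"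
  by unfold_locales
    (simp_all add: smult_residue_def lookup_add lookup_mult_zero lookup_one algebra_simps)

text \<open>A complex \<open>\<dots> \<rightarrow> P\<^sub>2 \<rightarrow> P\<^sub>1 \<rightarrow> P\<^sub>0\<close> of \<open>\<int>\<^sup>n\<close>-graded free modules: \<open>P\<^sub>i\<close> has basis
  \<open>basis P i\<close>, the basis element \<open>b\<close> has degree \<open>mdeg P i b\<close>, and \<open>bdry P i\<close> is the
  differential \<open>P\<^sub>i \<rightarrow> P\<^sub>i\<^sub>-\<^sub>1\<close> for \<open>i \<ge> 1\<close> (extended to the ambient free module;
  \<open>bdry P 0\<close> is irrelevant).\<close>

record (overloaded) ('n, 'k) graded_free_complex =
  basis :: "nat \<Rightarrow> nat set"
  mdeg :: "nat \<Rightarrow> nat \<Rightarrow> 'n \<Rightarrow> int"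
  bdry :: "nat \<Rightarrow> ('n, 'k) free_mod \<Rightarrow> ('n, 'k) free_mod"

text \<open>\<open>P\<^sub>i \<otimes> J\<close> for an ideal \<open>J\<close>: as \<open>P\<^sub>i\<close> is free, it is the direct sum of copies of
  \<open>J\<close> indexed by the basis. For \<open>J = UNIV\<close> this is \<open>P\<^sub>i\<close> itself.\<close>

definition term_tensor ::
  "('n, 'k::comm_ring_1) graded_free_complex \<Rightarrow> nat \<Rightarrow> ('n, 'k) mpoly set \<Rightarrow> ('n, 'k) free_mod set"
  where
  "term_tensor P i J =
     {z. Poly_Mapping.keys z \<subseteq> basis P i \<and> (\<forall>b \<in> basis P i. Poly_Mapping.lookup z b \<in> J)}"

definition free_homogeneous ::
  "('n, 'k::comm_ring_1) graded_free_complex \<Rightarrow> nat \<Rightarrow> ('n \<Rightarrow> int) \<Rightarrow> ('n, 'k) free_mod \<Rightarrow> bool"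
  where
  "free_homogeneous P i a z \<longleftrightarrow>
     (\<forall>b \<in> basis P i. mhomogeneous (\<lambda>v. a v - mdeg P i b v) (Poly_Mapping.lookup z b))"

text \<open>\<open>P\<close> is a \<open>\<int>\<^sup>n\<close>-graded free resolution of \<open>K = S/(x\<^sub>1,\<dots>,x\<^sub>n)\<close>, where \<open>K\<close> sits in
  degree \<open>0\<close>: the differentials and the augmentation \<open>\<epsilon> : P\<^sub>0 \<rightarrow> K\<close> are \<open>S\<close>-linear of
  degree \<open>0\<close>, and the augmented complex is exact.\<close>

definition resolves_residue_field ::
  "('n, 'k::comm_ring_1) graded_free_complex \<Rightarrow> bool" where
  "resolves_residue_field P \<longleftrightarrow>
     (\<forall>i. module_hom smult_free smult_free (bdry P (Suc i))) \<and>
     (\<forall>i. bdry P (Suc i) ` term_tensor P (Suc i) UNIV \<subseteq> term_tensor P i UNIV) \<and>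
     (\<forall>i a. \<forall>z \<in> term_tensor P (Suc i) UNIV.
        free_homogeneous P (Suc i) a z \<longrightarrow> free_homogeneous P i a (bdry P (Suc i) z)) \<and>
     (\<forall>i. \<forall>z \<in> term_tensor P (Suc i) UNIV.
        bdry P (Suc i) z = 0 \<longleftrightarrow> z \<in> bdry P (Suc (Suc i)) ` term_tensor P (Suc (Suc i)) UNIV) \<and>
     (\<exists>\<epsilon>. module_hom smult_free smult_residue \<epsilon> \<and>
        (\<forall>a. \<forall>z \<in> term_tensor P 0 UNIV. free_homogeneous P 0 a z \<and> a \<noteq> (\<lambda>_. 0) \<longrightarrow> \<epsilon> z = 0) \<and>
        \<epsilon> ` term_tensor P 0 UNIV = UNIV \<and>
        (\<forall>z \<in> term_tensor P 0 UNIV. \<epsilon> z = 0 \<longleftrightarrow> z \<in> bdry P 1 ` term_tensor P 1 UNIV))"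

text \<open>Degree \<open>a\<close> cycles and boundaries of \<open>P \<otimes> J\<close> in homological degree \<open>i\<close>; every
  element of \<open>P\<^sub>0 \<otimes> J\<close> is a cycle.\<close>

definition tor_cycles ::
  "('n, 'k::comm_ring_1) graded_free_complex \<Rightarrow> nat \<Rightarrow> ('n, 'k) mpoly set \<Rightarrow> ('n \<Rightarrow> int)
     \<Rightarrow> ('n, 'k) free_mod set" where
  "tor_cycles P i J a =
     {z \<in> term_tensor P i J. free_homogeneous P i a z \<and> (i = 0 \<or> bdry P i z = 0)}"

definition tor_boundaries ::
  "('n, 'k::comm_ring_1) graded_free_complex \<Rightarrow> nat \<Rightarrow> ('n, 'k) mpoly set \<Rightarrow> ('n \<Rightarrow> int)
     \<Rightarrow> ('n, 'k) free_mod set" where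
  "tor_boundaries P i J a =
     {bdry P (Suc i) y | y. y \<in> term_tensor P (Suc i) J \<and> free_homogeneous P (Suc i) a y}"

text \<open>\<open>Tor\<^sub>i(K, J)\<^sub>a \<noteq> 0\<close>, where \<open>Tor\<^sub>i(K, J)\<close> is the homology of \<open>P \<otimes> J\<close> for a
  \<open>\<int>\<^sup>n\<close>-graded free resolution \<open>P\<close> of \<open>K\<close>. As the homology does not depend on \<open>P\<close>,
  asking for some resolution and asking for all of them is the same.\<close>

definition Tor_nonzero ::
  "nat \<Rightarrow> ('n, 'k::comm_ring_1) mpoly set \<Rightarrow> ('n \<Rightarrow> int) \<Rightarrow> bool" where
  "Tor_nonzero i J a \<longleftrightarrow>
     (\<exists>P. resolves_residue_field P \<and> tor_cycles P i J a \<noteq> tor_boundaries P i J a)"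

definition HS :: "nat \<Rightarrow> ('n, 'k::comm_ring_1) mpoly set \<Rightarrow> ('n, 'k) mpoly set" where
  "HS i J = ideal_gen {xmonom a | a. Tor_nonzero i J (\<lambda>v. int (Poly_Mapping.lookup a v))}"


section \<open>Graphs\<close>

text \<open>A graph on the whole type \<open>'n\<close> is given by its adjacency relation.\<close>

definition simple_graph :: "('n \<Rightarrow> 'n \<Rightarrow> bool) \<Rightarrow> bool" where
  "simple_graph E \<longleftrightarrow> symp E \<and> irreflp E"

definition connected_graph :: "('n \<Rightarrow> 'n \<Rightarrow> bool) \<Rightarrow> bool" where
  "connected_graph E \<longleftrightarrow> (\<forall>u v. E\<^sup>*\<^sup>* u v)"

text \<open>An induced cycle, listed as \<open>c\<^sub>0, \<dots>, c\<^sub>l\<^sub>-\<^sub>1\<close> in cyclic order: the only edges among its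
  vertices join cyclically consecutive ones. Triangles are included.\<close>

definition induced_cycle :: "('n \<Rightarrow> 'n \<Rightarrow> bool) \<Rightarrow> 'n list \<Rightarrow> bool" where
  "induced_cycle E c \<longleftrightarrow>
     3 \<le> length c \<and> distinct c \<and>
     (\<forall>i < length c. \<forall>j < length c.
        E (c ! i) (c ! j) \<longleftrightarrow> j = Suc i mod length c \<or> i = Suc j mod length c)"

definition induced_odd_cycle :: "('n \<Rightarrow> 'n \<Rightarrow> bool) \<Rightarrow> 'n list \<Rightarrow> bool" where
  "induced_odd_cycle E c \<longleftrightarrow> induced_cycle E c \<and> odd (length c)"

definition distance_at_most_one :: "('n \<Rightarrow> 'n \<Rightarrow> bool) \<Rightarrow> 'n list \<Rightarrow> 'n list \<Rightarrow> bool" where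
  "distance_at_most_one E c d \<longleftrightarrow>
     (\<exists>u \<in> set c. \<exists>v \<in> set d. E u v) \<or> set c \<inter> set d \<noteq> {}"

definition edge_ideal :: "('n \<Rightarrow> 'n \<Rightarrow> bool) \<Rightarrow> ('n, 'k::comm_ring_1) mpoly set" where
  "edge_ideal E = ideal_gen {xvar u * xvar v | u v. E u v}"

end

theory Submission
  imports Defs "HOL-Library.Countable" "HOL-Library.Multiset" "HOL-Library.Infinite_Set"
begin

text \<open>
  By the Koszul complex, \<open>Tor\<^sub>n\<^sub>-\<^sub>1(K, J)\<close> is the socle of \<open>S/J\<close> shifted by \<open>(1, \<dots>, 1)\<close>. A monomial
  \<open>x\<^sup>a\<close> in the socle of \<open>S/I(G)\<^sup>k\<close> has degree \<open>2k - 1\<close>: read \<open>a\<close> as vertex capacities, so that \<open>k - 1\<close> is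
  the size of a maximum matching, and suppose that one leaves \<open>x\<close> and \<open>y\<close> unsaturated. As in Gallai's
  lemma, the relation that no maximum matching leaves both of two vertices unsaturated is an
  equivalence on the deficient vertices that contains adjacency, and the component of each of them is
  not bipartite. So the components of \<open>x\<close> and \<open>y\<close> contain induced odd cycles, and distance at most
  one of these puts \<open>x\<close> and \<open>y\<close> in one class, a contradiction.

  For degree reasons the socle degrees are therefore closed under adding an edge while \<open>k\<close> grows by
  one. As \<open>x\<^sub>v x\<^sup>a\<close> is a product of \<open>k\<close> edges for each vertex \<open>v\<close>, Dickson's lemma on edge multisets shows
  that for large \<open>k\<close> every socle degree arises in this way.
\<close>

text \<open>\<open>Tor_nonzero\<close> asks for some graded resolution of the residue field, so
  nothing can be read off the Koszul complex before Tor is known not to depend on the resolution.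
  The comparison theorem is therefore proved in multigraded form: lifts are chosen on basis elements
  and cut down to the right homogeneous component. On the graph side, the lower bound on the degree
  is immediate: \<open>k\<close> edges fit into \<open>a\<close> plus one vertex, so
  \<open>2 k \<le> size a + 1\<close>. For the upper bound, the component of a deficient vertex
  \<open>x\<close> is not bipartite because raising the capacity of \<open>x\<close> by one admits
  one more edge; the larger matching can be chosen to have degree \<open>s\<close> plus twice
  \<open>x\<close>, where \<open>s\<close> is the degree of a maximum matching missing
  \<open>x\<close>. The size \<open>2 k - 1\<close> is one short of \<open>k\<close> edges, which is
  why adding an edge preserves both halves of the socle condition. Dickson's lemma is applied to
  edge multisets and not to exponent vectors because containment of edge multisets splits off actual
  edges, which divisibility of monomials does not.\<close>

abbreviation lookup where "lookup \<equiv> Poly_Mapping.lookup"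
abbreviation keys where "keys \<equiv> Poly_Mapping.keys"
abbreviation single where "single \<equiv> Poly_Mapping.single"

interpretation ring_mod: module "(*) :: 'a::comm_ring_1 \<Rightarrow> 'a \<Rightarrow> 'a"
  by (rule module_self)

interpretation free_mod: module
  "smult_free :: ('n, 'k::comm_ring_1) mpoly \<Rightarrow> ('n, 'k) free_mod \<Rightarrow> ('n, 'k) free_mod"
  by (rule module_smult_free)

abbreviation is_ideal :: "'a::comm_ring_1 set \<Rightarrow> bool" where
  "is_ideal J \<equiv> ring_mod.subspace J"

lemma ideal_mult_right: "is_ideal J \<Longrightarrow> x \<in> J \<Longrightarrow> r * x \<in> J"
  by (rule ring_mod.subspace_scale)

lemma ideal_mult_left: "is_ideal J \<Longrightarrow> x \<in> J \<Longrightarrow> x * r \<in> J"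
  using ring_mod.subspace_scale[of J x r] by (simp add: mult.commute)

lemma is_ideal_UNIV [simp]: "is_ideal UNIV"
  by (simp add: ring_mod.subspace_def)

section \<open>Linear maps between free modules\<close>

lemma free_expand:
  fixes z :: "('n, 'k::comm_ring_1) free_mod"
  shows "z = (\<Sum>b\<in>keys z. smult_free (lookup z b) (single b 1))"
  by (rule poly_mapping_eqI)
    (auto simp: lookup_sum lookup_smult_free lookup_single when_def if_distrib in_keys_iff cong: if_cong)

definition lin_ext ::
  "(nat \<Rightarrow> ('n, 'k::comm_ring_1) free_mod) \<Rightarrow> ('n, 'k) free_mod \<Rightarrow> ('n, 'k) free_mod" where
  "lin_ext g z = (\<Sum>b\<in>keys z. smult_free (lookup z b) (g b))"

lemma lin_ext_superset:
  assumes "finite B" "keys z \<subseteq> B"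
  shows "lin_ext g z = (\<Sum>b\<in>B. smult_free (lookup z b) (g b))"
  unfolding lin_ext_def
  by (rule sum.mono_neutral_left) (use assms in \<open>auto simp: in_keys_iff\<close>)

lemma keys_smult_free: "keys (smult_free r z) \<subseteq> keys z"
  by (auto simp: in_keys_iff lookup_smult_free)

lemma module_hom_lin_ext: "module_hom smult_free smult_free (lin_ext g)"
proof -
  have "lin_ext g (x + y) = lin_ext g x + lin_ext g y" for x y
  proof -
    let ?B = "keys x \<union> keys y"
    have "keys (x + y) \<subseteq> ?B" by (rule Poly_Mapping.keys_add)
    then show ?thesis
      by (simp add: lin_ext_superset[of ?B] lookup_add free_mod.scale_left_distrib sum.distrib)
  qed
  moreover have "lin_ext g (smult_free r x) = smult_free r (lin_ext g x)" for r x
    using keys_smult_free[of r x]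
    by (simp add: lin_ext_superset[of "keys x"] lookup_smult_free free_mod.scale_sum_right)
  ultimately show ?thesis
    by unfold_locales auto
qed

lemma lin_ext_single [simp]: "lin_ext g (single b 1) = g b"
  by (simp add: lin_ext_def)

lemma module_hom_expand:
  assumes "module_hom smult_free s f"
  shows "f z = (\<Sum>b\<in>keys z. s (lookup z b) (f (single b 1)))"
proof -
  interpret module_hom smult_free s f by fact
  show ?thesis
    by (subst (1) free_expand[of z]) (simp add: sum scale)
qed

section \<open>Graded maps between graded free modules\<close>

lemma mhomogeneous_0 [simp]: "mhomogeneous c 0"
  by (simp add: mhomogeneous_def)

lemma mhomogeneous_add: "mhomogeneous c p \<Longrightarrow> mhomogeneous c q \<Longrightarrow> mhomogeneous c (p + q)"
  using Poly_Mapping.keys_add[of p q] unfolding mhomogeneous_def by blast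

lemma mhomogeneous_diff:
  fixes p q :: "('n, 'k::ab_group_add) mpoly"
  assumes "mhomogeneous c p" "mhomogeneous c q"
  shows "mhomogeneous c (p - q)"
proof -
  have "m \<in> keys p \<or> m \<in> keys q" if "m \<in> keys (p - q)" for m
    using that by (auto simp: in_keys_iff lookup_minus)
  then show ?thesis
    using assms unfolding mhomogeneous_def by blast
qed

lemma mhomogeneous_sum: "(\<And>i. i \<in> A \<Longrightarrow> mhomogeneous c (f i)) \<Longrightarrow> mhomogeneous c (sum f A)"
  by (induction A rule: infinite_finite_induct) (auto intro: mhomogeneous_add)

lemma mhomogeneous_mult:
  assumes "mhomogeneous c p" "mhomogeneous d q"
  shows "mhomogeneous (\<lambda>v. c v + d v) (p * q)"
  using keys_mult[of p q] assms unfolding mhomogeneous_def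
  by (fastforce simp: lookup_add)

text \<open>A degree 0 map between two terms is encoded by a linear map of the ambient free modules.
  Identities between such maps are therefore only claimed on
  \<open>term_tensor P i UNIV\<close>.\<close>

definition graded_map where
  "graded_map P i Q j f \<longleftrightarrow> module_hom smult_free smult_free f \<and>
     f ` term_tensor P i UNIV \<subseteq> term_tensor Q j UNIV \<and>
     (\<forall>a. \<forall>z \<in> term_tensor P i UNIV. free_homogeneous P i a z \<longrightarrow> free_homogeneous Q j a (f z))"

lemma term_tensor_UNIV: "z \<in> term_tensor P i UNIV \<longleftrightarrow> keys z \<subseteq> basis P i"
  by (simp add: term_tensor_def)

lemma term_tensor_mono: "z \<in> term_tensor P i J \<Longrightarrow> z \<in> term_tensor P i UNIV"
  by (simp add: term_tensor_def)

lemma term_tensor_iff: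
  assumes "is_ideal J"
  shows "z \<in> term_tensor P i J \<longleftrightarrow> keys z \<subseteq> basis P i \<and> (\<forall>b. lookup z b \<in> J)"
  using ring_mod.subspace_0[OF assms] unfolding term_tensor_def
  by (auto simp: subset_iff in_keys_iff) metis

lemma term_tensor_subspace:
  assumes "is_ideal J"
  shows "free_mod.subspace (term_tensor P i J)"
proof (rule free_mod.subspaceI)
  show "0 \<in> term_tensor P i J"
    using ring_mod.subspace_0[OF assms] by (simp add: term_tensor_def)
next
  fix x y assume "x \<in> term_tensor P i J" "y \<in> term_tensor P i J"
  then show "x + y \<in> term_tensor P i J"
    using Poly_Mapping.keys_add[of x y] ring_mod.subspace_add[OF assms]
    by (simp add: term_tensor_iff[OF assms] lookup_add) blast
next
  fix r x assume "x \<in> term_tensor P i J"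
  then show "smult_free r x \<in> term_tensor P i J"
    using keys_smult_free[of r x] ideal_mult_right[OF assms]
    by (simp add: term_tensor_iff[OF assms] lookup_smult_free) blast
qed

lemma free_homogeneous_0 [simp]: "free_homogeneous P i a 0"
  by (simp add: free_homogeneous_def)

lemma free_homogeneous_add:
  "free_homogeneous P i a x \<Longrightarrow> free_homogeneous P i a y \<Longrightarrow> free_homogeneous P i a (x + y)"
  by (simp add: free_homogeneous_def lookup_add mhomogeneous_add)

lemma free_homogeneous_diff:
  "free_homogeneous P i a x \<Longrightarrow> free_homogeneous P i a y \<Longrightarrow> free_homogeneous P i a (x - y)"
  by (simp add: free_homogeneous_def lookup_minus mhomogeneous_diff)

lemma free_homogeneous_single:
  "b \<in> basis P i \<Longrightarrow> mhomogeneous (\<lambda>v. a v - mdeg P i b v) p \<Longrightarrow> free_homogeneous P i a (single b p)"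
  by (auto simp: free_homogeneous_def lookup_single when_def)

lemma basis_element:
  assumes "b \<in> basis P i"
  shows "single b 1 \<in> term_tensor P i UNIV" "free_homogeneous P i (mdeg P i b) (single b 1)"
  using assms by (auto simp: term_tensor_UNIV mhomogeneous_def intro!: free_homogeneous_single)

context
  fixes P Q :: "('n, 'k::comm_ring_1) graded_free_complex" and i j f
  assumes f: "graded_map P i Q j f"
begin

lemma graded_map_hom: "module_hom smult_free smult_free f"
  using f by (simp add: graded_map_def)

lemma graded_map_UNIV: "z \<in> term_tensor P i UNIV \<Longrightarrow> f z \<in> term_tensor Q j UNIV"
  using f by (auto simp: graded_map_def)

lemma graded_map_homogeneous:
  "z \<in> term_tensor P i UNIV \<Longrightarrow> free_homogeneous P i a z \<Longrightarrow> free_homogeneous Q j a (f z)"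
  using f by (auto simp: graded_map_def)

text \<open>The coefficients of \<open>f z\<close> are linear combinations of those of
  \<open>z\<close>, so the same function \<open>f\<close> also serves as the map obtained by
  tensoring with \<open>J\<close>.\<close>

lemma graded_map_tensor:
  assumes J: "is_ideal J" and z: "z \<in> term_tensor P i J"
  shows "f z \<in> term_tensor Q j J"
proof -
  have "lookup (f z) c \<in> J" for c
    unfolding module_hom_expand[OF graded_map_hom, of z] lookup_sum lookup_smult_free
    using J z by (intro ring_mod.subspace_sum ideal_mult_left) (auto simp: term_tensor_iff)
  moreover have "f z \<in> term_tensor Q j UNIV"
    using graded_map_UNIV term_tensor_mono z by blast
  ultimately show ?thesis
    using J by (simp add: term_tensor_iff)
qed

end

lemma graded_map_comp:
  assumes "graded_map P i Q j f" "graded_map Q j R k g"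
  shows "graded_map P i R k (\<lambda>z. g (f z))"
proof -
  have "module_hom smult_free smult_free (g \<circ> f)"
    using assms[THEN graded_map_hom] by (rule module_hom_compose)
  then show ?thesis
    using assms by (auto simp: graded_map_def comp_def image_subset_iff)
qed

lemma graded_map_diff:
  assumes "graded_map P i Q j f" "graded_map P i Q j g"
  shows "graded_map P i Q j (\<lambda>z. f z - g z)"
proof -
  interpret f: module_hom smult_free smult_free f by (rule graded_map_hom) fact
  interpret g: module_hom smult_free smult_free g by (rule graded_map_hom) fact
  have "module_hom smult_free smult_free (\<lambda>z. f z - g z)"
    by unfold_locales (simp_all add: f.add g.add f.scale g.scale free_mod.scale_right_diff_distrib)
  moreover have "f z - g z \<in> term_tensor Q j UNIV" if "z \<in> term_tensor P i UNIV" for z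
    using graded_map_UNIV[OF assms(1) that] graded_map_UNIV[OF assms(2) that]
    by (intro free_mod.subspace_diff[OF term_tensor_subspace]) auto
  moreover have "free_homogeneous Q j a (f z - g z)"
    if "z \<in> term_tensor P i UNIV" "free_homogeneous P i a z" for a z
    using graded_map_homogeneous[OF assms(1) that] graded_map_homogeneous[OF assms(2) that]
    by (rule free_homogeneous_diff)
  ultimately show ?thesis
    by (simp add: graded_map_def image_subset_iff)
qed

lemma graded_map_id: "graded_map P i P i (\<lambda>z. z)"
proof -
  have "module_hom smult_free smult_free (\<lambda>z. z)"
    by unfold_locales simp_all
  then show ?thesis
    by (simp add: graded_map_def)
qed

lemma graded_map_lin_ext:
  assumes "\<And>b. b \<in> basis P i \<Longrightarrow> g b \<in> term_tensor Q j UNIV"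
    and "\<And>b. b \<in> basis P i \<Longrightarrow> free_homogeneous Q j (mdeg P i b) (g b)"
  shows "graded_map P i Q j (lin_ext g)"
  unfolding graded_map_def
proof (intro conjI allI ballI impI module_hom_lin_ext subsetI)
  fix y assume "y \<in> lin_ext g ` term_tensor P i UNIV"
  then obtain z where z: "keys z \<subseteq> basis P i" "y = lin_ext g z"
    by (auto simp: term_tensor_UNIV)
  show "y \<in> term_tensor Q j UNIV"
    unfolding z lin_ext_def
    by (intro free_mod.subspace_sum free_mod.subspace_scale term_tensor_subspace assms)
      (use z in auto)
next
  fix a z assume "z \<in> term_tensor P i UNIV" and hom: "free_homogeneous P i a z"
  then have z: "keys z \<subseteq> basis P i" by (simp add: term_tensor_UNIV)
  show "free_homogeneous Q j a (lin_ext g z)"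
    unfolding free_homogeneous_def
  proof
    fix c assume c: "c \<in> basis Q j"
    have "mhomogeneous (\<lambda>v. a v - mdeg Q j c v) (lookup z b * lookup (g b) c)" if b: "b \<in> keys z" for b
    proof -
      have "mhomogeneous (\<lambda>v. a v - mdeg P i b v) (lookup z b)"
        using hom z b by (auto simp: free_homogeneous_def)
      moreover have "mhomogeneous (\<lambda>v. mdeg P i b v - mdeg Q j c v) (lookup (g b) c)"
        using assms(2) z b c by (auto simp: free_homogeneous_def)
      ultimately show ?thesis
        by (auto dest: mhomogeneous_mult)
    qed
    then show "mhomogeneous (\<lambda>v. a v - mdeg Q j c v) (lookup (lin_ext g z) c)"
      by (auto simp: lin_ext_def lookup_sum lookup_smult_free intro!: mhomogeneous_sum)
  qed
qed

lemma module_hom_eq_on_term: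
  assumes "module_hom smult_free s f" "module_hom smult_free s g"
    and "\<And>b. b \<in> basis P i \<Longrightarrow> f (single b 1) = g (single b 1)"
    and "z \<in> term_tensor P i UNIV"
  shows "f z = g z"
  unfolding module_hom_expand[OF assms(1), of z] module_hom_expand[OF assms(2), of z]
  using assms(3,4) by (intro sum.cong) (auto simp: term_tensor_UNIV)

section \<open>Homogeneous components\<close>

definition poly_comp :: "('n \<Rightarrow> int) \<Rightarrow> ('n, 'k::comm_ring_1) mpoly \<Rightarrow> ('n, 'k) mpoly" where
  "poly_comp c p = (\<Sum>m\<in>{m \<in> keys p. (\<lambda>v. int (lookup m v)) = c}. single m (lookup p m))"

lemma lookup_poly_comp:
  "lookup (poly_comp c p) m = (if (\<lambda>v. int (lookup m v)) = c then lookup p m else 0)"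
  by (auto simp: poly_comp_def lookup_sum lookup_single when_def sum.delta' in_keys_iff)

definition free_comp ::
  "('n, 'k::comm_ring_1) graded_free_complex \<Rightarrow> nat \<Rightarrow> ('n \<Rightarrow> int) \<Rightarrow> ('n, 'k) free_mod
     \<Rightarrow> ('n, 'k) free_mod" where
  "free_comp P i a z = (\<Sum>b\<in>keys z. single b (poly_comp (\<lambda>v. a v - mdeg P i b v) (lookup z b)))"

lemma lookup_free_comp:
  "lookup (free_comp P i a z) b = poly_comp (\<lambda>v. a v - mdeg P i b v) (lookup z b)"
  by (auto simp: free_comp_def lookup_sum lookup_single when_def sum.delta' in_keys_iff
      intro!: poly_mapping_eqI simp: lookup_poly_comp)

lemma free_comp_add: "free_comp P i a (x + y) = free_comp P i a x + free_comp P i a y"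
  by (auto intro!: poly_mapping_eqI simp: lookup_free_comp lookup_add lookup_poly_comp)

lemma free_comp_homogeneous: "free_homogeneous P i a (free_comp P i a z)"
  by (auto simp: free_homogeneous_def lookup_free_comp mhomogeneous_def in_keys_iff
      lookup_poly_comp fun_eq_iff split: if_splits)

lemma free_comp_term: "z \<in> term_tensor P i UNIV \<Longrightarrow> free_comp P i a z \<in> term_tensor P i UNIV"
proof -
  have "keys (free_comp P i a z) \<subseteq> keys z"
    by (auto simp: in_keys_iff lookup_free_comp poly_comp_def)
  then show "z \<in> term_tensor P i UNIV \<Longrightarrow> free_comp P i a z \<in> term_tensor P i UNIV"
    by (auto simp: term_tensor_UNIV)
qed

lemma poly_comp_homogeneous:
  assumes "mhomogeneous d p"
  shows "poly_comp c p = (if c = d then p else 0)"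
proof (rule poly_mapping_eqI)
  fix m
  have "lookup p m = 0 \<or> (\<lambda>v. int (lookup m v)) = d"
    using assms by (auto simp: mhomogeneous_def in_keys_iff)
  then show "lookup (poly_comp c p) m = lookup (if c = d then p else 0) m"
    by (auto simp: lookup_poly_comp)
qed

lemma free_comp_of_homogeneous:
  assumes z: "z \<in> term_tensor P i UNIV" "free_homogeneous P i d z"
  shows "free_comp P i a z = (if a = d then z else 0)"
proof (rule poly_mapping_eqI)
  fix b
  show "lookup (free_comp P i a z) b = lookup (if a = d then z else 0) b"
  proof (cases "b \<in> basis P i")
    case True
    then have "mhomogeneous (\<lambda>v. d v - mdeg P i b v) (lookup z b)"
      using z by (simp add: free_homogeneous_def)
    then show ?thesis
      by (auto simp: lookup_free_comp poly_comp_homogeneous fun_eq_iff)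
  next
    case False
    then have "lookup z b = 0"
      using z by (auto simp: term_tensor_UNIV in_keys_iff)
    then show ?thesis
      by (simp add: lookup_free_comp poly_comp_def)
  qed
qed

text \<open>Monomial multiples of basis elements are homogeneous, so additive statements about
  \<open>free_comp\<close> reduce to the homogeneous case.\<close>

lemma term_induct [consumes 1, case_names zero monomial add]:
  assumes z: "z \<in> term_tensor P i UNIV"
    and "R 0"
    and mono: "\<And>b m c. b \<in> basis P i \<Longrightarrow> R (single b (single m c))"
    and add: "\<And>x y. x \<in> term_tensor P i UNIV \<Longrightarrow> y \<in> term_tensor P i UNIV \<Longrightarrow> R x \<Longrightarrow> R y \<Longrightarrow> R (x + y)"
  shows "R z"
proof -
  have tt: "x \<in> term_tensor P i UNIV \<and> y \<in> term_tensor P i UNIV \<longrightarrow> x + y \<in> term_tensor P i UNIV" for x y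
    using free_mod.subspace_add[OF term_tensor_subspace[OF is_ideal_UNIV]] by blast
  have poly: "R (single b p) \<and> single b p \<in> term_tensor P i UNIV" if b: "b \<in> basis P i" for b p
  proof -
    have "R (single b (\<Sum>m\<in>M. single m (lookup p m)))
      \<and> single b (\<Sum>m\<in>M. single m (lookup p m)) \<in> term_tensor P i UNIV" if "finite M" for M
      using that
    proof (induction M)
      case empty
      then show ?case using \<open>R 0\<close> b by (simp add: term_tensor_UNIV)
    next
      case (insert m M)
      have "R (single b (single m (lookup p m)))" "single b (single m (lookup p m)) \<in> term_tensor P i UNIV"
        using b mono by (auto simp: term_tensor_UNIV)
      with insert show ?case
        by (auto simp: Poly_Mapping.single_add intro!: add tt[rule_format])
    qed
    moreover have "p = (\<Sum>m\<in>keys p. single m (lookup p m))"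
      by (rule poly_mapping_eqI) (auto simp: lookup_sum lookup_single when_def sum.delta' in_keys_iff)
    ultimately show ?thesis
      by (metis finite_keys)
  qed
  have "R (\<Sum>b\<in>B. single b (lookup z b)) \<and> (\<Sum>b\<in>B. single b (lookup z b)) \<in> term_tensor P i UNIV"
    if "finite B" "B \<subseteq> basis P i" for B
    using that
  proof (induction B)
    case empty
    then show ?case using \<open>R 0\<close> by (simp add: term_tensor_UNIV)
  next
    case (insert b B)
    with poly[of b "lookup z b"] show ?case
      by (auto intro!: add tt[rule_format])
  qed
  from this[of "keys z"] z have "R (\<Sum>b\<in>keys z. single b (lookup z b))"
    by (simp add: term_tensor_UNIV)
  also have "(\<Sum>b\<in>keys z. single b (lookup z b)) = z"
    by (rule poly_mapping_eqI) (auto simp: lookup_sum lookup_single when_def sum.delta' in_keys_iff)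
  finally show ?thesis .
qed

lemma monomial_element:
  assumes "b \<in> basis P i"
  shows "single b (single m c) \<in> term_tensor P i UNIV"
    "free_homogeneous P i (\<lambda>v. mdeg P i b v + int (lookup m v)) (single b (single m c))"
  using assms by (auto simp: term_tensor_UNIV mhomogeneous_def intro!: free_homogeneous_single)

text \<open>Both sides are additive, and on a homogeneous element both are either \<open>f\<close>
  of it or 0. This allows any preimage of a homogeneous element to be replaced by a homogeneous
  one.\<close>

lemma graded_map_comp_commute:
  assumes f: "graded_map P i Q j f" and z: "z \<in> term_tensor P i UNIV"
  shows "f (free_comp P i a z) = free_comp Q j a (f z)"
proof -
  interpret f: module_hom smult_free smult_free f by (rule graded_map_hom) fact
  show ?thesis
    using z
  proof (induction rule: term_induct)
    case zero
    then show ?case by (simp add: free_comp_def)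
  next
    case (monomial b m c)
    let ?t = "single b (single m c)" and ?d = "\<lambda>v. mdeg P i b v + int (lookup m v)"
    note t = monomial_element[OF monomial, of m c]
    show ?case
      using free_comp_of_homogeneous[OF t, of a]
        free_comp_of_homogeneous[OF graded_map_UNIV[OF f t(1)] graded_map_homogeneous[OF f t], of a]
      by simp
  next
    case (add x y)
    then show ?case by (simp add: free_comp_add f.add)
  qed
qed

section \<open>Comparison of resolutions\<close>

text \<open>Free modules are projective in the graded sense: pick a preimage for the image of each
  basis element, keep only its component in the degree of that basis element, and extend
  linearly.\<close>

lemma graded_lift:
  assumes g: "graded_map P i Q j g" and d: "graded_map Q k Q j d"
    and im: "\<And>z. z \<in> term_tensor P i UNIV \<Longrightarrow> g z \<in> d ` term_tensor Q k UNIV"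
  obtains f where "graded_map P i Q k f" "\<And>z. z \<in> term_tensor P i UNIV \<Longrightarrow> d (f z) = g z"
proof -
  have "\<exists>y \<in> term_tensor Q k UNIV. free_homogeneous Q k (mdeg P i b) y \<and> d y = g (single b 1)"
    if b: "b \<in> basis P i" for b
  proof -
    note t = basis_element[OF b]
    from im[OF t(1)] obtain y where y: "y \<in> term_tensor Q k UNIV" "d y = g (single b 1)"
      by auto
    have "d (free_comp Q k (mdeg P i b) y) = free_comp Q j (mdeg P i b) (g (single b 1))"
      using graded_map_comp_commute[OF d y(1)] y(2) by simp
    also have "\<dots> = g (single b 1)"
      using free_comp_of_homogeneous[OF graded_map_UNIV[OF g t(1)] graded_map_homogeneous[OF g t]]
      by simp
    finally show ?thesis
      using free_comp_homogeneous free_comp_term[OF y(1)] by blast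
  qed
  then obtain u where u: "\<And>b. b \<in> basis P i \<Longrightarrow> u b \<in> term_tensor Q k UNIV"
      "\<And>b. b \<in> basis P i \<Longrightarrow> free_homogeneous Q k (mdeg P i b) (u b)"
      "\<And>b. b \<in> basis P i \<Longrightarrow> d (u b) = g (single b 1)"
    by metis
  have f: "graded_map P i Q k (lin_ext u)"
    by (rule graded_map_lin_ext) (use u in auto)
  moreover have "d (lin_ext u z) = g z" if "z \<in> term_tensor P i UNIV" for z
    by (rule module_hom_eq_on_term[OF graded_map_hom[OF graded_map_comp[OF f d]] graded_map_hom[OF g] _ that])
      (simp add: u(3))
  ultimately show ?thesis
    using that by blast
qed

text \<open>Names the map bound by the existential in \<open>resolves_residue_field\<close>, because
  comparison maps have to commute with fixed choices of it.\<close>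

definition augmentation ::
  "('n, 'k::comm_ring_1) graded_free_complex \<Rightarrow> (('n, 'k) free_mod \<Rightarrow> 'k) \<Rightarrow> bool" where
  "augmentation P \<epsilon> \<longleftrightarrow> module_hom smult_free smult_residue \<epsilon> \<and>
     (\<forall>a. \<forall>z \<in> term_tensor P 0 UNIV. free_homogeneous P 0 a z \<and> a \<noteq> (\<lambda>_. 0) \<longrightarrow> \<epsilon> z = 0) \<and>
     \<epsilon> ` term_tensor P 0 UNIV = UNIV \<and>
     (\<forall>z \<in> term_tensor P 0 UNIV. \<epsilon> z = 0 \<longleftrightarrow> z \<in> bdry P 1 ` term_tensor P 1 UNIV)"

lemma resolvesD:
  assumes "resolves_residue_field P"
  shows "graded_map P (Suc i) P i (bdry P (Suc i))"
    "z \<in> term_tensor P (Suc i) UNIV \<Longrightarrow>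
      bdry P (Suc i) z = 0 \<longleftrightarrow> z \<in> bdry P (Suc (Suc i)) ` term_tensor P (Suc (Suc i)) UNIV"
    "\<exists>\<epsilon>. augmentation P \<epsilon>"
proof -
  note r = assms[unfolded resolves_residue_field_def]
  show "graded_map P (Suc i) P i (bdry P (Suc i))"
    unfolding graded_map_def
    using r[THEN conjunct1] r[THEN conjunct2, THEN conjunct1]
      r[THEN conjunct2, THEN conjunct2, THEN conjunct1] by simp
  show "z \<in> term_tensor P (Suc i) UNIV \<Longrightarrow>
      bdry P (Suc i) z = 0 \<longleftrightarrow> z \<in> bdry P (Suc (Suc i)) ` term_tensor P (Suc (Suc i)) UNIV"
    using r[THEN conjunct2, THEN conjunct2, THEN conjunct2, THEN conjunct1] by simp
  show "\<exists>\<epsilon>. augmentation P \<epsilon>"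
    unfolding augmentation_def
    by (rule r[THEN conjunct2, THEN conjunct2, THEN conjunct2, THEN conjunct2])
qed

lemma augmentationD:
  assumes "augmentation P \<epsilon>"
  shows "module_hom smult_free smult_residue \<epsilon>"
    "z \<in> term_tensor P 0 UNIV \<Longrightarrow> free_homogeneous P 0 a z \<Longrightarrow> a \<noteq> (\<lambda>_. 0) \<Longrightarrow> \<epsilon> z = 0"
    "\<exists>z \<in> term_tensor P 0 UNIV. \<epsilon> z = c"
    "z \<in> term_tensor P 0 UNIV \<Longrightarrow> \<epsilon> z = 0 \<longleftrightarrow> z \<in> bdry P (Suc 0) ` term_tensor P (Suc 0) UNIV"
proof -
  note r = assms[unfolded augmentation_def]
  show "module_hom smult_free smult_residue \<epsilon>"
    by (rule r[THEN conjunct1])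
  show "z \<in> term_tensor P 0 UNIV \<Longrightarrow> free_homogeneous P 0 a z \<Longrightarrow> a \<noteq> (\<lambda>_. 0) \<Longrightarrow> \<epsilon> z = 0"
    using r[THEN conjunct2, THEN conjunct1] by simp
  show "\<exists>z \<in> term_tensor P 0 UNIV. \<epsilon> z = c"
    using r[THEN conjunct2, THEN conjunct2, THEN conjunct1] by (metis UNIV_I imageE)
  show "z \<in> term_tensor P 0 UNIV \<Longrightarrow> \<epsilon> z = 0 \<longleftrightarrow> z \<in> bdry P (Suc 0) ` term_tensor P (Suc 0) UNIV"
    using r[THEN conjunct2, THEN conjunct2, THEN conjunct2] by simp
qed

lemma bdry_bdry:
  assumes "resolves_residue_field P" "z \<in> term_tensor P (Suc (Suc i)) UNIV"
  shows "bdry P (Suc i) (bdry P (Suc (Suc i)) z) = 0"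
  using assms(2) resolvesD(2)[OF assms(1) graded_map_UNIV[OF resolvesD(1)[OF assms(1)] assms(2)]]
  by simp

text \<open>The residue field sits in degree 0, so the components of all other degrees are
  killed.\<close>

lemma augmentation_comp:
  assumes "augmentation P \<epsilon>" and z: "z \<in> term_tensor P 0 UNIV"
  shows "\<epsilon> (free_comp P 0 (\<lambda>_. 0) z) = \<epsilon> z"
proof -
  interpret f: module_hom smult_free smult_residue \<epsilon>
    by (rule augmentationD(1)) fact
  show ?thesis
    using z
  proof (induction rule: term_induct)
    case zero
    then show ?case by (simp add: free_comp_def)
  next
    case (monomial b m c)
    let ?d = "\<lambda>v. mdeg P 0 b v + int (lookup m v)"
    note t = monomial_element[OF monomial, of m c]
    have "\<epsilon> (single b (single m c)) = 0" if "?d \<noteq> (\<lambda>_. 0)"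
      by (rule augmentationD(2)[OF assms(1) t that])
    then show ?case
      using free_comp_of_homogeneous[OF t, of "\<lambda>_. 0"] by auto
  next
    case (add x y)
    then show ?case by (simp add: free_comp_add f.add)
  qed
qed

definition chain_map where
  "chain_map P Q f \<longleftrightarrow> (\<forall>i. graded_map P i Q i (f i)) \<and>
     (\<forall>i. \<forall>z \<in> term_tensor P (Suc i) UNIV. bdry Q (Suc i) (f (Suc i) z) = f i (bdry P (Suc i) z))"

text \<open>Existence half of the comparison theorem: the identity of the residue field lifts step
  by step, by freeness of \<open>P\<close> and exactness of \<open>Q\<close>.\<close>

lemma chain_map_exists:
  assumes P: "resolves_residue_field P" and Q: "resolves_residue_field Q"
    and eP: "augmentation P \<epsilon>P" and eQ: "augmentation Q \<epsilon>Q"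
  obtains f where "chain_map P Q f" "\<And>z. z \<in> term_tensor P 0 UNIV \<Longrightarrow> \<epsilon>Q (f 0 z) = \<epsilon>P z"
proof -
  have homP: "module_hom smult_free smult_residue \<epsilon>P" and homQ: "module_hom smult_free smult_residue \<epsilon>Q"
    using eP eQ by (simp_all add: augmentationD(1))
  have "\<exists>y \<in> term_tensor Q 0 UNIV. free_homogeneous Q 0 (mdeg P 0 b) y \<and> \<epsilon>Q y = \<epsilon>P (single b 1)"
    if b: "b \<in> basis P 0" for b
  proof (cases "mdeg P 0 b = (\<lambda>_. 0)")
    \<comment> \<open>Only basis elements of degree 0 can have a nonzero augmentation; for them the
      degree 0 component of any preimage will do, for the others 0.\<close>
    case True
    obtain y where "y \<in> term_tensor Q 0 UNIV" "\<epsilon>Q y = \<epsilon>P (single b 1)"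
      using augmentationD(3)[OF eQ] by blast
    then show ?thesis
      using augmentation_comp[OF eQ] free_comp_homogeneous[of Q 0 "\<lambda>_. 0" y] True
      by (intro bexI[of _ "free_comp Q 0 (\<lambda>_. 0) y"]) (auto intro: free_comp_term)
  next
    case False
    then have "\<epsilon>P (single b 1) = 0"
      using augmentationD(2)[OF eP basis_element[OF b]] by simp
    moreover have "\<epsilon>Q 0 = 0"
      using homQ by (rule module_hom.zero)
    ultimately show ?thesis
      by (intro bexI[of _ 0]) (auto simp: term_tensor_UNIV)
  qed
  then obtain u where u: "\<And>b. b \<in> basis P 0 \<Longrightarrow> u b \<in> term_tensor Q 0 UNIV"
      "\<And>b. b \<in> basis P 0 \<Longrightarrow> free_homogeneous Q 0 (mdeg P 0 b) (u b)"
      "\<And>b. b \<in> basis P 0 \<Longrightarrow> \<epsilon>Q (u b) = \<epsilon>P (single b 1)"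
    by metis
  have f0: "graded_map P 0 Q 0 (lin_ext u)"
    by (rule graded_map_lin_ext) (use u in auto)
  have e0: "\<epsilon>Q (lin_ext u z) = \<epsilon>P z" if "z \<in> term_tensor P 0 UNIV" for z
  proof -
    have "module_hom smult_free smult_residue (\<epsilon>Q \<circ> lin_ext u)"
      using module_hom_lin_ext homQ by (rule module_hom_compose)
    from module_hom_eq_on_term[OF this homP _ that] show ?thesis by (simp add: u(3))
  qed
  \<comment> \<open>The invariant that makes the next lift possible: cycles of \<open>P\<close> are sent into the image
    of the next differential of \<open>Q\<close>.\<close>
  let ?ok = "\<lambda>i f. graded_map P i Q i f \<and> (i = 0 \<longrightarrow> f = lin_ext u) \<and>
      (\<forall>z \<in> term_tensor P (Suc i) UNIV. f (bdry P (Suc i) z) \<in> bdry Q (Suc i) ` term_tensor Q (Suc i) UNIV)"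
  let ?step = "\<lambda>i f f'. \<forall>z \<in> term_tensor P (Suc i) UNIV. bdry Q (Suc i) (f' z) = f (bdry P (Suc i) z)"
  have "\<exists>f. \<forall>i. ?ok i (f i) \<and> ?step i (f i) (f (Suc i))"
  proof (rule dependent_nat_choice)
    have "lin_ext u (bdry P 1 z) \<in> bdry Q 1 ` term_tensor Q 1 UNIV" if z: "z \<in> term_tensor P 1 UNIV" for z
    proof -
      have 1: "bdry P 1 z \<in> term_tensor P 0 UNIV"
        using graded_map_UNIV[OF resolvesD(1)[OF P, of 0]] z by simp
      have "\<epsilon>P (bdry P 1 z) = 0"
        using augmentationD(4)[OF eP 1] z by simp
      then show ?thesis
        using augmentationD(4)[OF eQ graded_map_UNIV[OF f0 1]] e0[OF 1] by simp
    qed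
    then show "\<exists>f. ?ok 0 f"
      using f0 by auto
  next
    fix f i assume ok: "?ok i f"
    note dP = resolvesD(1)[OF P, of i] and dQ = resolvesD(1)[OF Q, of i]
    obtain f' where f': "graded_map P (Suc i) Q (Suc i) f'"
        "\<And>z. z \<in> term_tensor P (Suc i) UNIV \<Longrightarrow> bdry Q (Suc i) (f' z) = f (bdry P (Suc i) z)"
      using graded_lift[OF graded_map_comp[OF dP] dQ, of f] ok by metis
    have "f' (bdry P (Suc (Suc i)) z) \<in> bdry Q (Suc (Suc i)) ` term_tensor Q (Suc (Suc i)) UNIV"
      if z: "z \<in> term_tensor P (Suc (Suc i)) UNIV" for z
    proof -
      have 1: "bdry P (Suc (Suc i)) z \<in> term_tensor P (Suc i) UNIV"
        using graded_map_UNIV[OF resolvesD(1)[OF P]] z by blast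
      have "bdry Q (Suc i) (f' (bdry P (Suc (Suc i)) z)) = f 0"
        using f'(2)[OF 1] bdry_bdry[OF P z] by simp
      also have "f 0 = 0"
        using ok graded_map_hom module_hom.zero by blast
      finally show ?thesis
        using resolvesD(2)[OF Q graded_map_UNIV[OF f'(1) 1]] by blast
    qed
    then show "\<exists>f'. ?ok (Suc i) f' \<and> ?step i f f'"
      using f' by auto
  qed
  then obtain f where f: "\<And>i. ?ok i (f i)" "\<And>i. ?step i (f i) (f (Suc i))"
    by auto
  show thesis
  proof (rule that)
    show "chain_map P Q f"
      using f by (simp add: chain_map_def)
    show "\<epsilon>Q (f 0 z) = \<epsilon>P z" if "z \<in> term_tensor P 0 UNIV" for z
      using f(1)[of 0] e0 that by simp
  qed
qed

text \<open>Uniqueness half of the comparison theorem: a chain map that covers zero on the residue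
  field is null homotopic. It will be applied to the identity minus a round trip between two
  resolutions.\<close>

lemma homotopy_exists:
  assumes P: "resolves_residue_field P" and Q: "resolves_residue_field Q"
    and eQ: "augmentation Q \<epsilon>" and f: "chain_map P Q f"
    and f0: "\<And>z. z \<in> term_tensor P 0 UNIV \<Longrightarrow> \<epsilon> (f 0 z) = 0"
  obtains h where "\<And>i. graded_map P i Q (Suc i) (h i)"
    "\<And>z. z \<in> term_tensor P 0 UNIV \<Longrightarrow> f 0 z = bdry Q 1 (h 0 z)"
    "\<And>i z. z \<in> term_tensor P (Suc i) UNIV \<Longrightarrow>
       f (Suc i) z = bdry Q (Suc (Suc i)) (h (Suc i) z) + h i (bdry P (Suc i) z)"
proof -
  have fg: "graded_map P i Q i (f i)" for i
    using f by (simp add: chain_map_def)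
  have fd: "bdry Q (Suc i) (f (Suc i) z) = f i (bdry P (Suc i) z)" if "z \<in> term_tensor P (Suc i) UNIV" for i z
    using f that by (simp add: chain_map_def)
  \<comment> \<open>The last conjunct is the homotopy identity on boundaries, where the term with
    the previous homotopy vanishes. It makes the next map to be lifted take values in
    cycles.\<close>
  let ?ok = "\<lambda>i h. graded_map P i Q (Suc i) h \<and>
      (i = 0 \<longrightarrow> (\<forall>z \<in> term_tensor P 0 UNIV. f 0 z = bdry Q 1 (h z))) \<and>
      (\<forall>z \<in> term_tensor P (Suc i) UNIV. f i (bdry P (Suc i) z) = bdry Q (Suc i) (h (bdry P (Suc i) z)))"
  let ?step = "\<lambda>i h h'. \<forall>z \<in> term_tensor P (Suc i) UNIV.
      f (Suc i) z = bdry Q (Suc (Suc i)) (h' z) + h (bdry P (Suc i) z)"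
  have "\<exists>h. \<forall>i. ?ok i (h i) \<and> ?step i (h i) (h (Suc i))"
  proof (rule dependent_nat_choice)
    have "f 0 z \<in> bdry Q (Suc 0) ` term_tensor Q (Suc 0) UNIV" if z: "z \<in> term_tensor P 0 UNIV" for z
      using f0[OF z] augmentationD(4)[OF eQ graded_map_UNIV[OF fg z]] by simp
    then obtain h where "graded_map P 0 Q (Suc 0) h"
        "\<And>z. z \<in> term_tensor P 0 UNIV \<Longrightarrow> bdry Q (Suc 0) (h z) = f 0 z"
      using graded_lift[OF fg[of 0] resolvesD(1)[OF Q, of 0]] by metis
    then show "\<exists>h. ?ok 0 h"
      using graded_map_UNIV[OF resolvesD(1)[OF P, of 0]] by auto
  next
    fix h i assume ok: "?ok i h"
    note dP = resolvesD(1)[OF P, of i] and dQ = resolvesD(1)[OF Q, of "Suc i"]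
    have h: "graded_map P i Q (Suc i) h" using ok by blast
    let ?g = "\<lambda>z. f (Suc i) z - h (bdry P (Suc i) z)"
    have g: "graded_map P (Suc i) Q (Suc i) ?g"
      by (intro graded_map_diff fg graded_map_comp[OF dP h])
    have "?g z \<in> bdry Q (Suc (Suc i)) ` term_tensor Q (Suc (Suc i)) UNIV"
      if z: "z \<in> term_tensor P (Suc i) UNIV" for z
    proof -
      interpret d: module_hom smult_free smult_free "bdry Q (Suc i)"
        by (rule graded_map_hom[OF resolvesD(1)[OF Q]])
      have "bdry Q (Suc i) (?g z) = 0"
        using fd[OF z] ok z by (simp add: d.diff)
      then show ?thesis
        using resolvesD(2)[OF Q graded_map_UNIV[OF g z]] by blast
    qed
    then obtain h' where h': "graded_map P (Suc i) Q (Suc (Suc i)) h'"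
        "\<And>z. z \<in> term_tensor P (Suc i) UNIV \<Longrightarrow> bdry Q (Suc (Suc i)) (h' z) = ?g z"
      using graded_lift[OF g dQ] by metis
    have "f (Suc i) (bdry P (Suc (Suc i)) z)
        = bdry Q (Suc (Suc i)) (h' (bdry P (Suc (Suc i)) z))"
      if z: "z \<in> term_tensor P (Suc (Suc i)) UNIV" for z
    proof -
      have "h 0 = 0" using h graded_map_hom module_hom.zero by blast
      then show ?thesis
        using h'(2)[OF graded_map_UNIV[OF resolvesD(1)[OF P] z]] bdry_bdry[OF P z] by simp
    qed
    then show "\<exists>h'. ?ok (Suc i) h' \<and> ?step i h h'"
      using h' by auto
  qed
  then obtain h where h: "\<forall>i. ?ok i (h i) \<and> ?step i (h i) (h (Suc i))" ..
  show thesis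
  proof (rule that)
    show "graded_map P i Q (Suc i) (h i)" for i
      using h by simp
    show "f 0 z = bdry Q 1 (h 0 z)" if "z \<in> term_tensor P 0 UNIV" for z
      using spec[OF h, of 0] that by simp
    show "f (Suc i) z = bdry Q (Suc (Suc i)) (h (Suc i) z) + h i (bdry P (Suc i) z)"
      if "z \<in> term_tensor P (Suc i) UNIV" for i z
      using spec[OF h, of i] that by simp
  qed
qed

section \<open>Independence of Tor from the resolution\<close>

lemma tor_boundaries_subset:
  assumes P: "resolves_residue_field P" and J: "is_ideal J"
  shows "tor_boundaries P i J a \<subseteq> tor_cycles P i J a"
proof
  fix z assume "z \<in> tor_boundaries P i J a"
  then obtain y where y: "y \<in> term_tensor P (Suc i) J" "free_homogeneous P (Suc i) a y" "z = bdry P (Suc i) y"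
    by (auto simp: tor_boundaries_def)
  note d = resolvesD(1)[OF P, of i]
  have "i = 0 \<or> bdry P i z = 0"
    using bdry_bdry[OF P] term_tensor_mono[OF y(1)] y(3) by (cases i) auto
  then show "z \<in> tor_cycles P i J a"
    using y graded_map_tensor[OF d J y(1)] graded_map_homogeneous[OF d term_tensor_mono[OF y(1)] y(2)]
    by (simp add: tor_cycles_def)
qed

lemma chain_map_cycles:
  assumes f: "chain_map P Q f" and J: "is_ideal J" and z: "z \<in> tor_cycles P i J a"
  shows "f i z \<in> tor_cycles Q i J a"
proof -
  have fg: "graded_map P i Q i (f i)" for i
    using f by (simp add: chain_map_def)
  have fd: "bdry Q (Suc i) (f (Suc i) z) = f i (bdry P (Suc i) z)" if "z \<in> term_tensor P (Suc i) UNIV" for i z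
    using f that by (simp add: chain_map_def)
  have z': "z \<in> term_tensor P i J" "free_homogeneous P i a z" "i = 0 \<or> bdry P i z = 0"
    using z by (auto simp: tor_cycles_def)
  note zt = term_tensor_mono[OF z'(1)]
  have "i = 0 \<or> bdry Q i (f i z) = 0"
  proof (cases i)
    case (Suc i')
    then have "bdry Q i (f i z) = f i' 0"
      using fd[of z i'] zt z'(3) by simp
    then show ?thesis
      using module_hom.zero[OF graded_map_hom[OF fg]] by simp
  qed simp
  then show ?thesis
    using graded_map_tensor[OF fg J z'(1)] graded_map_homogeneous[OF fg zt z'(2)]
    by (simp add: tor_cycles_def)
qed

text \<open>Carry a cycle \<open>w\<close> of \<open>Q\<close> to \<open>P\<close>, where it bounds,
  and back: \<open>f i (g i w)\<close> bounds, and it differs from \<open>w\<close> by a boundary.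
  Everything happens with coefficients in \<open>J\<close> because the comparison maps and the
  homotopy are linear.\<close>

lemma tor_vanishing_transfer:
  assumes P: "resolves_residue_field P" and Q: "resolves_residue_field Q" and J: "is_ideal J"
    and eq: "tor_cycles P i J a = tor_boundaries P i J a"
  shows "tor_cycles Q i J a = tor_boundaries Q i J a"
proof (rule antisym[OF subsetI tor_boundaries_subset[OF Q J]])
  fix w assume w: "w \<in> tor_cycles Q i J a"
  obtain \<epsilon>P \<epsilon>Q where eP: "augmentation P \<epsilon>P" and eQ: "augmentation Q \<epsilon>Q"
    using resolvesD(3) P Q by metis
  obtain f where f: "chain_map P Q f" "\<And>z. z \<in> term_tensor P 0 UNIV \<Longrightarrow> \<epsilon>Q (f 0 z) = \<epsilon>P z"
    using chain_map_exists[OF P Q eP eQ] by metis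
  obtain g where g: "chain_map Q P g" "\<And>z. z \<in> term_tensor Q 0 UNIV \<Longrightarrow> \<epsilon>P (g 0 z) = \<epsilon>Q z"
    using chain_map_exists[OF Q P eQ eP] by metis
  have fg: "graded_map P i Q i (f i)" "graded_map Q i P i (g i)" for i
    using f g by (auto simp: chain_map_def)
  \<comment> \<open>The identity and the round trip through \<open>P\<close> induce the same map on
    the residue field, so their difference is null homotopic.\<close>
  define e where "e i z = z - f i (g i z)" for i z
  have dQ: "module_hom smult_free smult_free (bdry Q (Suc i))" for i
    by (rule graded_map_hom[OF resolvesD(1)[OF Q]])
  have e: "chain_map Q Q e"
    unfolding chain_map_def
  proof (intro conjI allI ballI)
    show "graded_map Q i Q i (e i)" for i
      unfolding e_def by (intro graded_map_diff graded_map_id graded_map_comp[OF fg(2) fg(1)])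
    fix i z assume z: "z \<in> term_tensor Q (Suc i) UNIV"
    have "bdry Q (Suc i) (f (Suc i) (g (Suc i) z)) = f i (g i (bdry Q (Suc i) z))"
      using f(1) g(1) z graded_map_UNIV[OF fg(2) z] by (simp add: chain_map_def)
    then show "bdry Q (Suc i) (e (Suc i) z) = e i (bdry Q (Suc i) z)"
      by (simp add: e_def module_hom.diff[OF dQ])
  qed
  have e0: "\<epsilon>Q (e 0 z) = 0" if z: "z \<in> term_tensor Q 0 UNIV" for z
  proof -
    have "module_hom smult_free smult_residue \<epsilon>Q"
      by (rule augmentationD(1)[OF eQ])
    from module_hom.diff[OF this] show ?thesis
      using f(2)[OF graded_map_UNIV[OF fg(2) z]] g(2)[OF z] by (simp add: e_def)
  qed
  obtain h where h: "\<And>i. graded_map Q i Q (Suc i) (h i)"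
    "\<And>z. z \<in> term_tensor Q 0 UNIV \<Longrightarrow> e 0 z = bdry Q 1 (h 0 z)"
    "\<And>i z. z \<in> term_tensor Q (Suc i) UNIV \<Longrightarrow>
       e (Suc i) z = bdry Q (Suc (Suc i)) (h (Suc i) z) + h i (bdry Q (Suc i) z)"
    using homotopy_exists[OF Q Q eQ e e0] by metis
  have wt: "w \<in> term_tensor Q i J" "free_homogeneous Q i a w" "w \<in> term_tensor Q i UNIV"
    using w term_tensor_mono by (auto simp: tor_cycles_def)
  have "e i w = bdry Q (Suc i) (h i w)"
  proof (cases i)
    case 0
    then show ?thesis using h(2) wt by simp
  next
    case (Suc i')
    then have "bdry Q (Suc i') w = 0"
      using w by (simp add: tor_cycles_def)
    then show ?thesis
      using h(3)[of w i'] wt Suc module_hom.zero[OF graded_map_hom[OF h(1)]] by simp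
  qed
  moreover obtain y where y: "y \<in> term_tensor P (Suc i) J" "free_homogeneous P (Suc i) a y"
      "g i w = bdry P (Suc i) y"
    using chain_map_cycles[OF g(1) J w] eq by (auto simp: tor_boundaries_def)
  have "f i (g i w) = bdry Q (Suc i) (f (Suc i) y)"
    using f(1) term_tensor_mono[OF y(1)] y(3) by (simp add: chain_map_def)
  ultimately have "w = bdry Q (Suc i) (h i w + f (Suc i) y)"
    by (simp add: e_def module_hom.add[OF dQ] algebra_simps)
  moreover have "h i w + f (Suc i) y \<in> term_tensor Q (Suc i) J"
    using free_mod.subspace_add[OF term_tensor_subspace[OF J]] graded_map_tensor[OF h(1) J wt(1)]
      graded_map_tensor[OF fg(1) J y(1)] by blast
  moreover have "free_homogeneous Q (Suc i) a (h i w + f (Suc i) y)"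
    using graded_map_homogeneous[OF h(1) wt(3,2)]
      graded_map_homogeneous[OF fg(1) term_tensor_mono[OF y(1)] y(2)] by (rule free_homogeneous_add)
  ultimately show "w \<in> tor_boundaries Q i J a"
    unfolding tor_boundaries_def by blast
qed

text \<open>Vanishing for one resolution forces vanishing for all, so the existential in
  \<open>Tor_nonzero\<close> can be evaluated at any convenient \<open>P\<close>.\<close>

lemma Tor_nonzero_iff:
  assumes "resolves_residue_field P" "is_ideal J"
  shows "Tor_nonzero i J a \<longleftrightarrow> tor_cycles P i J a \<noteq> tor_boundaries P i J a"
  using assms tor_vanishing_transfer unfolding Tor_nonzero_def by metis

section \<open>The Koszul complex\<close>

lemma lookup_single_mult:
  fixes p :: "('n, 'k::comm_ring_1) mpoly"
  shows "lookup (single a c * p) (a + m) = c * lookup p m"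
  by (simp add: lookup_mult lookup_single when_mult)

lemma lookup_single_mult_not:
  fixes p :: "('n, 'k::comm_ring_1) mpoly"
  assumes "\<And>q. m \<noteq> a + q"
  shows "lookup (single a c * p) m = 0"
  using assms by (simp add: lookup_mult lookup_single when_mult)

lemma lookup_xvar_mult:
  fixes p :: "('n, 'k::comm_ring_1) mpoly"
  shows "lookup (xvar u * p) m = (if u \<in> keys m then lookup p (m - single u 1) else 0)"
proof (cases "u \<in> keys m")
  case True
  then have "m = single u 1 + (m - single u 1)"
    by (intro poly_mapping_eqI) (auto simp: lookup_add lookup_minus lookup_single when_def in_keys_iff)
  then show ?thesis
    using True lookup_single_mult[of "single u 1" 1 p "m - single u 1"]
    by (simp add: xvar_def xmonom_def)
next
  case False
  then have "m \<noteq> single u 1 + q" for q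
    by (auto simp: in_keys_iff lookup_add)
  then show ?thesis
    using False by (simp add: xvar_def xmonom_def lookup_single_mult_not)
qed

text \<open>The exterior algebra sign for inserting \<open>u\<close> into \<tau>. The vertex type
  carries no order, so the order is borrowed from \<open>to_nat\<close>.\<close>

definition ksign :: "'n::finite \<Rightarrow> 'n set \<Rightarrow> 'a::comm_ring_1" where
  "ksign u \<tau> = (- 1) ^ card {w \<in> \<tau>. to_nat w < to_nat u}"

lemma lookup_ksign_mult:
  fixes p :: "('n, 'k::comm_ring_1) mpoly"
  shows "lookup (ksign u \<tau> * p) m = ksign u \<tau> * lookup p m"
  by (cases "even (card {w \<in> \<tau>. to_nat w < to_nat u})") (simp_all add: ksign_def)

lemma ksign_square [simp]: "ksign u \<tau> * ksign u \<tau> = 1"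
  by (simp add: ksign_def flip: power_add)

lemma ksign_mult_mem_iff:
  assumes "is_ideal J"
  shows "ksign u \<tau> * p \<in> J \<longleftrightarrow> p \<in> J"
proof
  assume "ksign u \<tau> * p \<in> J"
  from ideal_mult_right[OF assms this, of "ksign u \<tau>"] show "p \<in> J"
    by (simp flip: mult.assoc)
qed (rule ideal_mult_right[OF assms])

lemma ksign_insert:
  assumes "v \<notin> \<tau>"
  shows "ksign u (insert v \<tau>) = (if to_nat v < to_nat u then - ksign u \<tau> else ksign u \<tau>)"
proof -
  have "{w \<in> insert v \<tau>. to_nat w < to_nat u} =
      (if to_nat v < to_nat u then insert v {w \<in> \<tau>. to_nat w < to_nat u} else {w \<in> \<tau>. to_nat w < to_nat u})"
    by auto
  then show ?thesis
    using assms by (simp add: ksign_def)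
qed

text \<open>Exactly one of the two vertices precedes the other, so exactly one of the two insertions
  flips a sign.\<close>

lemma ksign_anticommute:
  assumes "u \<notin> \<tau>" "w \<notin> \<tau>" "u \<noteq> w"
  shows "ksign u \<tau> * ksign w (insert u \<tau>) = - (ksign w \<tau> * ksign u (insert w \<tau>))"
proof -
  have "to_nat u \<noteq> to_nat w" using assms by simp
  then show ?thesis
    using assms by (auto simp: ksign_insert)
qed

text \<open>The exterior basis element of \<tau> has index \<open>to_nat \<tau>\<close>. The
  differential is written by target coefficient, and one map serves all homological degrees, since
  the index determines the cardinality of \<tau>.\<close>

definition koszul_bdry :: "('n::finite, 'k::comm_ring_1) free_mod \<Rightarrow> ('n, 'k) free_mod" where
  "koszul_bdry z = (\<Sum>\<tau>\<in>UNIV. single (to_nat \<tau>)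
     (\<Sum>u\<in>-\<tau>. ksign u \<tau> * (xvar u * lookup z (to_nat (insert u \<tau>)))))"

definition koszul :: "('n::finite, 'k::comm_ring_1) graded_free_complex" where
  "koszul = \<lparr>basis = (\<lambda>i. to_nat ` {\<tau> :: 'n set. card \<tau> = i}),
     mdeg = (\<lambda>i b v. of_bool (v \<in> (from_nat b :: 'n set))), bdry = (\<lambda>i. koszul_bdry)\<rparr>"

lemma koszul_simps [simp]:
  "basis (koszul :: ('n::finite, 'k::comm_ring_1) graded_free_complex) i = to_nat ` {\<tau> :: 'n set. card \<tau> = i}"
  "mdeg (koszul :: ('n, 'k) graded_free_complex) i (to_nat \<tau>) v = of_bool (v \<in> \<tau>)"
  "bdry (koszul :: ('n, 'k) graded_free_complex) i = koszul_bdry"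
  by (simp_all add: koszul_def)

lemma lookup_koszul_bdry:
  "lookup (koszul_bdry z) (to_nat \<tau>) = (\<Sum>u\<in>-\<tau>. ksign u \<tau> * (xvar u * lookup z (to_nat (insert u \<tau>))))"
proof -
  have "lookup (koszul_bdry z) (to_nat \<tau>) = (\<Sum>\<sigma>\<in>UNIV. if \<sigma> = \<tau>
      then \<Sum>u\<in>-\<sigma>. ksign u \<sigma> * (xvar u * lookup z (to_nat (insert u \<sigma>))) else 0)"
    unfolding koszul_bdry_def lookup_sum
    by (intro sum.cong) (auto simp: lookup_single when_def)
  then show ?thesis by simp
qed

lemma keys_koszul_bdry: "keys (koszul_bdry (z :: ('n::finite, 'k::comm_ring_1) free_mod)) \<subseteq> range (to_nat :: 'n set \<Rightarrow> nat)"
proof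
  fix b assume b: "b \<in> keys (koszul_bdry z)"
  have "lookup (koszul_bdry z) b = 0" if "b \<notin> range (to_nat :: 'n set \<Rightarrow> nat)"
    unfolding koszul_bdry_def lookup_sum
    by (rule sum.neutral) (use that in \<open>auto simp: lookup_single when_def\<close>)
  with b show "b \<in> range (to_nat :: 'n set \<Rightarrow> nat)"
    by (auto simp: in_keys_iff)
qed

lemma free_mod_eqI:
  fixes x y :: "('n::finite, 'k::comm_ring_1) free_mod"
  assumes "keys x \<subseteq> range (to_nat :: 'n set \<Rightarrow> nat)" "keys y \<subseteq> range (to_nat :: 'n set \<Rightarrow> nat)"
    and "\<And>\<tau> :: 'n set. lookup x (to_nat \<tau>) = lookup y (to_nat \<tau>)"
  shows "x = y"
proof (rule poly_mapping_eqI)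
  fix b
  show "lookup x b = lookup y b"
  proof (cases "b \<in> range (to_nat :: 'n set \<Rightarrow> nat)")
    case True
    then show ?thesis using assms(3) by auto
  next
    case False
    then have "b \<notin> keys x" "b \<notin> keys y" using assms(1,2) by auto
    then show ?thesis by (simp add: in_keys_iff)
  qed
qed

lemma koszul_term_iff:
  fixes z :: "('n::finite, 'k::comm_ring_1) free_mod"
  shows "z \<in> term_tensor koszul i UNIV \<longleftrightarrow>
    keys z \<subseteq> range (to_nat :: 'n set \<Rightarrow> nat) \<and> (\<forall>\<tau> :: 'n set. lookup z (to_nat \<tau>) \<noteq> 0 \<longrightarrow> card \<tau> = i)"
  unfolding term_tensor_UNIV koszul_simps
proof (intro iffI conjI allI impI subsetI)
  fix \<tau> :: "'n set" assume "keys z \<subseteq> to_nat ` {\<tau> :: 'n set. card \<tau> = i}" "lookup z (to_nat \<tau>) \<noteq> 0"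
  then have "to_nat \<tau> \<in> to_nat ` {\<tau> :: 'n set. card \<tau> = i}" by (auto simp: in_keys_iff)
  then show "card \<tau> = i" by auto
next
  fix b assume "keys z \<subseteq> range (to_nat :: 'n set \<Rightarrow> nat) \<and> (\<forall>\<tau> :: 'n set. lookup z (to_nat \<tau>) \<noteq> 0 \<longrightarrow> card \<tau> = i)"
    and "b \<in> keys z"
  then show "b \<in> to_nat ` {\<tau> :: 'n set. card \<tau> = i}"
    by (auto simp: in_keys_iff)
qed auto

lemma koszul_homogeneous_iff:
  fixes z :: "('n::finite, 'k::comm_ring_1) free_mod"
  shows "free_homogeneous koszul i a z \<longleftrightarrow> (\<forall>\<tau> :: 'n set. card \<tau> = i \<longrightarrow>
    mhomogeneous (\<lambda>v. a v - of_bool (v \<in> \<tau>)) (lookup z (to_nat \<tau>)))"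
  by (auto simp: free_homogeneous_def)

lemma mhomogeneous_ksign_mult:
  "mhomogeneous c p \<Longrightarrow> mhomogeneous c (ksign u \<tau> * p)"
  by (auto simp: mhomogeneous_def in_keys_iff lookup_ksign_mult)

lemma mhomogeneous_xvar_mult:
  fixes p :: "('n, 'k::comm_ring_1) mpoly"
  assumes "mhomogeneous c p"
  shows "mhomogeneous (\<lambda>v. of_bool (v = u) + c v) (xvar u * p)"
  by (rule mhomogeneous_mult[OF _ assms])
    (auto simp: mhomogeneous_def xvar_def xmonom_def lookup_single when_def)

lemma graded_map_koszul_bdry:
  "graded_map (koszul :: ('n::finite, 'k::comm_ring_1) graded_free_complex) (Suc i) koszul i koszul_bdry"
  unfolding graded_map_def
proof (intro conjI allI ballI impI subsetI)
  show "module_hom smult_free smult_free (koszul_bdry :: ('n, 'k) free_mod \<Rightarrow> _)"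
  proof unfold_locales
    fix x y :: "('n, 'k) free_mod" and r
    show "koszul_bdry (x + y) = koszul_bdry x + koszul_bdry y"
    proof (rule free_mod_eqI[OF keys_koszul_bdry])
      show "keys (koszul_bdry x + koszul_bdry y) \<subseteq> range (to_nat :: 'n set \<Rightarrow> nat)"
        by (rule subset_trans[OF Poly_Mapping.keys_add Un_least[OF keys_koszul_bdry keys_koszul_bdry]])
    qed (simp add: lookup_koszul_bdry lookup_add distrib_left sum.distrib)
    show "koszul_bdry (smult_free r x) = smult_free r (koszul_bdry x)"
    proof (rule free_mod_eqI[OF keys_koszul_bdry])
      show "keys (smult_free r (koszul_bdry x)) \<subseteq> range (to_nat :: 'n set \<Rightarrow> nat)"
        using keys_smult_free keys_koszul_bdry by (rule subset_trans)
      show "lookup (koszul_bdry (smult_free r x)) (to_nat \<tau>) = lookup (smult_free r (koszul_bdry x)) (to_nat \<tau>)"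
        for \<tau> :: "'n set"
        unfolding lookup_koszul_bdry lookup_smult_free sum_distrib_left
        by (intro sum.cong) (simp_all add: mult.left_commute)
    qed
  qed
next
  fix y assume "y \<in> koszul_bdry ` term_tensor (koszul :: ('n, 'k) graded_free_complex) (Suc i) UNIV"
  then obtain z where z: "z \<in> term_tensor (koszul :: ('n, 'k) graded_free_complex) (Suc i) UNIV" "y = koszul_bdry z" by auto
  have "card \<tau> = i" if "lookup y (to_nat \<tau>) \<noteq> 0" for \<tau> :: "'n set"
  proof -
    have "lookup y (to_nat \<tau>) = 0" if "\<And>u. u \<notin> \<tau> \<Longrightarrow> lookup z (to_nat (insert u \<tau>)) = 0"
      unfolding z(2) lookup_koszul_bdry using that by (intro sum.neutral) simp
    with that obtain u where u: "u \<notin> \<tau>" "lookup z (to_nat (insert u \<tau>)) \<noteq> 0"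
      by blast
    then have "card (insert u \<tau>) = Suc i" using z(1) koszul_term_iff by blast
    then show ?thesis using u by simp
  qed
  then show "y \<in> term_tensor koszul i UNIV"
    unfolding koszul_term_iff using keys_koszul_bdry z(2) by blast
next
  fix a z assume "z \<in> term_tensor (koszul :: ('n, 'k) graded_free_complex) (Suc i) UNIV"
    and hom: "free_homogeneous (koszul :: ('n, 'k) graded_free_complex) (Suc i) a z"
  show "free_homogeneous koszul i a (koszul_bdry z)"
    unfolding koszul_homogeneous_iff lookup_koszul_bdry
  proof (intro allI impI mhomogeneous_sum)
    fix \<tau> :: "'n set" and u assume "card \<tau> = i" "u \<in> - \<tau>"
    then have "card (insert u \<tau>) = Suc i" by simp
    then have "mhomogeneous (\<lambda>v. a v - of_bool (v \<in> insert u \<tau>)) (lookup z (to_nat (insert u \<tau>)))"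
      using hom unfolding koszul_homogeneous_iff by blast
    from mhomogeneous_xvar_mult[OF this, of u]
    have "mhomogeneous (\<lambda>v. a v - of_bool (v \<in> \<tau>)) (xvar u * lookup z (to_nat (insert u \<tau>)))"
      using \<open>u \<in> - \<tau>\<close> by (rule_tac back_subst[of "\<lambda>c. mhomogeneous c _"]) (auto simp: fun_eq_iff)
    then show "mhomogeneous (\<lambda>v. a v - of_bool (v \<in> \<tau>)) (ksign u \<tau> * (xvar u * lookup z (to_nat (insert u \<tau>))))"
      by (rule mhomogeneous_ksign_mult)
  qed
qed

text \<open>In a fixed multidegree \<open>d\<close> the Koszul complex is the simplicial chain complex of the full
  simplex on the support of \<open>d\<close>; \<open>koszul_coeff\<close> reads off the chain.\<close>

definition indicator_exponent :: "'n::finite set \<Rightarrow> 'n \<Rightarrow>\<^sub>0 nat" where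
  "indicator_exponent \<tau> = Abs_poly_mapping (\<lambda>v. of_bool (v \<in> \<tau>))"

lemma lookup_indicator_exponent [simp]: "lookup (indicator_exponent \<tau>) v = of_bool (v \<in> \<tau>)"
  by (simp add: indicator_exponent_def)

lemma indicator_exponent_empty [simp]: "indicator_exponent {} = 0"
  by (rule poly_mapping_eqI) simp

definition koszul_coeff where
  "koszul_coeff z d \<tau> = lookup (lookup z (to_nat \<tau>)) (d - indicator_exponent \<tau>)"

lemma koszul_coeff_add_indicator:
  "koszul_coeff z (m + indicator_exponent \<tau>) \<tau> = lookup (lookup z (to_nat \<tau>)) m"
  by (simp add: koszul_coeff_def)

text \<open>Subtraction of exponents is truncated, so \<open>koszul_coeff\<close> is meaningful only
  when \<tau> lies in the support of \<open>d\<close>. There the factor \<open>xvar u\<close> makes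
  up for the larger indicator of \<open>insert u \<tau>\<close>, which leaves the simplicial
  boundary.\<close>

lemma koszul_coeff_bdry:
  assumes "\<tau> \<subseteq> keys d"
  shows "koszul_coeff (koszul_bdry z) d \<tau> = (\<Sum>u\<in>keys d - \<tau>. ksign u \<tau> * koszul_coeff z d (insert u \<tau>))"
proof -
  have "lookup (xvar u * lookup z (to_nat (insert u \<tau>))) (d - indicator_exponent \<tau>)
      = (if u \<in> keys d then koszul_coeff z d (insert u \<tau>) else 0)" if "u \<notin> \<tau>" for u
  proof -
    have "u \<in> keys (d - indicator_exponent \<tau>) \<longleftrightarrow> u \<in> keys d"
      using that by (simp add: in_keys_iff lookup_minus)
    moreover have "d - indicator_exponent \<tau> - single u 1 = d - indicator_exponent (insert u \<tau>)"
      using that by (intro poly_mapping_eqI) (auto simp: lookup_minus lookup_single when_def)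
    ultimately show ?thesis
      by (simp add: lookup_xvar_mult koszul_coeff_def)
  qed
  then have "koszul_coeff (koszul_bdry z) d \<tau>
      = (\<Sum>u\<in>-\<tau>. if u \<in> keys d then ksign u \<tau> * koszul_coeff z d (insert u \<tau>) else 0)"
    unfolding koszul_coeff_def[of "koszul_bdry z"] lookup_koszul_bdry lookup_sum lookup_ksign_mult
    by (intro sum.cong) auto
  also have "\<dots> = (\<Sum>u\<in>keys d - \<tau>. ksign u \<tau> * koszul_coeff z d (insert u \<tau>))"
    by (intro sum.mono_neutral_cong_right) auto
  finally show ?thesis .
qed

lemma koszul_eqI:
  fixes x y :: "('n::finite, 'k::comm_ring_1) free_mod"
  assumes "keys x \<subseteq> range (to_nat :: 'n set \<Rightarrow> nat)" "keys y \<subseteq> range (to_nat :: 'n set \<Rightarrow> nat)"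
    and "\<And>d \<tau>. \<tau> \<subseteq> keys d \<Longrightarrow> koszul_coeff x d \<tau> = koszul_coeff y d \<tau>"
  shows "x = y"
proof (rule free_mod_eqI[OF assms(1,2)], rule poly_mapping_eqI)
  fix \<tau> :: "'n set" and m
  have "\<tau> \<subseteq> keys (m + indicator_exponent \<tau>)"
    by (auto simp: in_keys_iff lookup_add)
  from assms(3)[OF this] show "lookup (lookup x (to_nat \<tau>)) m = lookup (lookup y (to_nat \<tau>)) m"
    by (simp add: koszul_coeff_add_indicator)
qed

lemma koszul_bdry_bdry:
  fixes z :: "('n::finite, 'k::comm_ring_1) free_mod"
  shows "koszul_bdry (koszul_bdry z) = 0"
proof (rule koszul_eqI[OF keys_koszul_bdry])
  fix d :: "'n \<Rightarrow>\<^sub>0 nat" and \<tau> :: "'n set" assume \<tau>: "\<tau> \<subseteq> keys d"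
  define A where "A = keys d - \<tau>"
  have fin: "finite A" by (simp add: A_def)
  define f where "f u w = ksign u \<tau> * ksign w (insert u \<tau>) * koszul_coeff z d (insert w (insert u \<tau>))" for u w
  have anti: "f u w = - f w u" if "u \<in> A" "w \<in> A" "u \<noteq> w" for u w
    using ksign_anticommute[of u \<tau> w, where 'b = 'k] that
    by (simp add: f_def A_def insert_commute)
  have "koszul_coeff (koszul_bdry (koszul_bdry z)) d \<tau> = (\<Sum>u\<in>A. \<Sum>w\<in>A - {u}. f u w)"
    unfolding koszul_coeff_bdry[OF \<tau>] A_def[symmetric]
  proof (rule sum.cong[OF refl])
    fix u assume u: "u \<in> A"
    have 1: "insert u \<tau> \<subseteq> keys d" using u \<tau> by (auto simp: A_def)
    have 2: "keys d - insert u \<tau> = A - {u}" by (auto simp: A_def)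
    show "ksign u \<tau> * koszul_coeff (koszul_bdry z) d (insert u \<tau>) = (\<Sum>w\<in>A - {u}. f u w)"
      unfolding koszul_coeff_bdry[OF 1] 2 sum_distrib_left f_def mult.assoc by (rule refl)
  qed
  \<comment> \<open>Antisymmetry alone would only show that twice the sum vanishes, which says
    nothing in characteristic 2. Splitting by the order of \<open>u\<close> and \<open>w\<close>
    pairs the terms instead.\<close>
  also have "\<dots> = (\<Sum>u\<in>A. (\<Sum>w\<in>A. if to_nat u < to_nat w then f u w else 0)
      + (\<Sum>w\<in>A. if to_nat w < to_nat u then f u w else 0))"
  proof (rule sum.cong[OF refl])
    fix u assume u: "u \<in> A"
    have "(\<Sum>w\<in>A. if to_nat u < to_nat w then f u w else 0) + (\<Sum>w\<in>A. if to_nat w < to_nat u then f u w else 0)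
       = (\<Sum>w\<in>A. if w = u then 0 else f u w)"
      unfolding sum.distrib[symmetric] by (intro sum.cong) (auto simp: not_less_iff_gr_or_eq)
    also have "\<dots> = (\<Sum>w\<in>A - {u}. f u w)"
      using fin by (intro sum.mono_neutral_cong_right) auto
    finally show "(\<Sum>w\<in>A - {u}. f u w) = (\<Sum>w\<in>A. if to_nat u < to_nat w then f u w else 0)
      + (\<Sum>w\<in>A. if to_nat w < to_nat u then f u w else 0)" by simp
  qed
  also have "\<dots> = (\<Sum>u\<in>A. \<Sum>w\<in>A. if to_nat u < to_nat w then f u w else 0)
      + (\<Sum>w\<in>A. \<Sum>u\<in>A. if to_nat w < to_nat u then f u w else 0)"
    unfolding sum.distrib by (subst (3) sum.swap) (rule refl)
  also have "\<dots> = (\<Sum>u\<in>A. \<Sum>w\<in>A. (if to_nat u < to_nat w then f u w else 0) + (if to_nat u < to_nat w then f w u else 0))"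
    by (simp add: sum.distrib)
  also have "\<dots> = 0"
    by (intro sum.neutral ballI) (auto dest: anti)
  finally show "koszul_coeff (koszul_bdry (koszul_bdry z)) d \<tau> = koszul_coeff 0 d \<tau>"
    by (simp add: koszul_coeff_def)
qed simp

text \<open>The contracting homotopy adds the least vertex of the support of the degree.\<close>

lemma koszul_exact:
  fixes z :: "('n::finite, 'k::comm_ring_1) free_mod"
  assumes z: "z \<in> term_tensor koszul i UNIV" and cyc: "koszul_bdry z = 0"
    and aug: "lookup (lookup z (to_nat ({} :: 'n set))) 0 = 0"
  shows "\<exists>y \<in> term_tensor koszul (Suc i) UNIV. koszul_bdry y = z"
proof -
  have "\<exists>v. d \<noteq> 0 \<longrightarrow> v \<in> keys d \<and> (\<forall>w\<in>keys d. to_nat v \<le> to_nat w)" for d :: "'n \<Rightarrow>\<^sub>0 nat"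
  proof (cases "d = 0")
    case False
    then obtain w where "w \<in> keys d"
      by (metis poly_mapping_eqI in_keys_iff lookup_zero)
    then show ?thesis
      using ex_has_least_nat[of "\<lambda>v. v \<in> keys d" w to_nat] by blast
  qed simp
  then obtain v where v: "\<And>d :: 'n \<Rightarrow>\<^sub>0 nat. d \<noteq> 0 \<Longrightarrow> v d \<in> keys d"
      "\<And>d w. d \<noteq> 0 \<Longrightarrow> w \<in> keys d \<Longrightarrow> to_nat (v d) \<le> to_nat w"
    by metis
  define F where "F d \<tau> = (if v d \<in> \<tau> \<and> \<tau> \<subseteq> keys d then koszul_coeff z d (\<tau> - {v d}) else 0)" for d \<tau>
  \<comment> \<open>Degrees in which \<open>z\<close> has a nonzero chain. There are finitely many,
    and the cone \<open>F\<close> vanishes in all others, which gives the finite support required by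
    \<open>Abs_poly_mapping\<close> below.\<close>
  define D where "D = (\<Union>\<sigma> :: 'n set. (\<lambda>m. m + indicator_exponent \<sigma>) ` keys (lookup z (to_nat \<sigma>)))"
  have FD: "d \<in> D" if "F d \<tau> \<noteq> 0" for d \<tau>
  proof -
    let ?\<sigma> = "\<tau> - {v d}"
    have "d - indicator_exponent ?\<sigma> \<in> keys (lookup z (to_nat ?\<sigma>))" "\<tau> \<subseteq> keys d"
      using that by (auto simp: F_def koszul_coeff_def in_keys_iff split: if_splits)
    moreover have "d = (d - indicator_exponent ?\<sigma>) + indicator_exponent ?\<sigma>"
      using \<open>\<tau> \<subseteq> keys d\<close>
      by (intro poly_mapping_eqI) (auto simp: lookup_add lookup_minus in_keys_iff subset_iff Suc_le_eq)
    ultimately show ?thesis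
      unfolding D_def by blast
  qed
  have "finite D" by (simp add: D_def)
  have fin: "finite {m. F (m + indicator_exponent \<tau>) \<tau> \<noteq> 0}" for \<tau>
  proof (rule finite_subset)
    show "{m. F (m + indicator_exponent \<tau>) \<tau> \<noteq> 0} \<subseteq> (\<lambda>d. d - indicator_exponent \<tau>) ` D"
      using FD by force
  qed (use \<open>finite D\<close> in auto)
  define y where "y = (\<Sum>\<tau>\<in>UNIV. single (to_nat \<tau>) (Abs_poly_mapping (\<lambda>m. F (m + indicator_exponent \<tau>) \<tau>)))"
  have y: "lookup y (to_nat \<tau>) = Abs_poly_mapping (\<lambda>m. F (m + indicator_exponent \<tau>) \<tau>)" for \<tau>
  proof -
    have "lookup y (to_nat \<tau>) = (\<Sum>\<sigma>\<in>UNIV. if \<sigma> = \<tau> then Abs_poly_mapping (\<lambda>m. F (m + indicator_exponent \<sigma>) \<sigma>) else 0)"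
      unfolding y_def lookup_sum by (intro sum.cong) (auto simp: lookup_single when_def)
    then show ?thesis by simp
  qed
  have ykeys: "keys y \<subseteq> range (to_nat :: 'n set \<Rightarrow> nat)"
  proof
    fix b assume b: "b \<in> keys y"
    have "lookup y b = 0" if "b \<notin> range (to_nat :: 'n set \<Rightarrow> nat)"
      unfolding y_def lookup_sum
      by (rule sum.neutral) (use that in \<open>auto simp: lookup_single when_def\<close>)
    with b show "b \<in> range (to_nat :: 'n set \<Rightarrow> nat)"
      by (auto simp: in_keys_iff)
  qed
  have yc: "koszul_coeff y d \<tau> = F d \<tau>" if "\<tau> \<subseteq> keys d" for d \<tau>
  proof -
    have "(d - indicator_exponent \<tau>) + indicator_exponent \<tau> = d"
      using that by (intro poly_mapping_eqI) (auto simp: lookup_add lookup_minus in_keys_iff subset_iff Suc_le_eq)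
    then show ?thesis
      by (simp add: koszul_coeff_def y fin)
  qed
  have "y \<in> term_tensor koszul (Suc i) UNIV"
    unfolding koszul_term_iff
  proof (intro conjI ykeys allI impI)
    fix \<tau> :: "'n set" assume "lookup y (to_nat \<tau>) \<noteq> 0"
    then obtain m where "F (m + indicator_exponent \<tau>) \<tau> \<noteq> 0"
      unfolding y by (metis poly_mapping_eqI lookup_Abs_poly_mapping[OF fin] lookup_zero)
    then obtain w where w: "w \<in> \<tau>" "lookup z (to_nat (\<tau> - {w})) \<noteq> 0"
      unfolding F_def koszul_coeff_def by (metis lookup_zero)
    then have "card (\<tau> - {w}) = i" using z unfolding koszul_term_iff by blast
    then show "card \<tau> = Suc i" using w(1) by (metis card_Suc_Diff1 finite_code)
  qed
  moreover have "koszul_bdry y = z"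
  proof (rule koszul_eqI[OF keys_koszul_bdry])
    show "keys z \<subseteq> range (to_nat :: 'n set \<Rightarrow> nat)" using z by (simp add: koszul_term_iff)
    fix d :: "'n \<Rightarrow>\<^sub>0 nat" and \<tau> :: "'n set" assume \<tau>: "\<tau> \<subseteq> keys d"
    have "(\<Sum>u\<in>keys d - \<tau>. ksign u \<tau> * F d (insert u \<tau>)) = koszul_coeff z d \<tau>"
    proof (cases "d = 0")
      \<comment> \<open>No vertex is available for a cone. Only the empty face is left, and
        \<open>aug\<close> kills its coefficient.\<close>
      case True
      then show ?thesis
        using \<tau> aug by (simp add: koszul_coeff_def)
    next
      case False
      note vd = v(1)[OF False]
      \<comment> \<open>The least vertex of the support precedes all others, so inserting it costs
        no sign.\<close>
      have s1: "ksign (v d) \<sigma> = (1 :: 'k)" if "\<sigma> \<subseteq> keys d" for \<sigma>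
      proof -
        have "{w \<in> \<sigma>. to_nat w < to_nat (v d)} = {}"
          using v(2)[OF False] that by (fastforce simp: not_less)
        then show ?thesis by (simp only: ksign_def card.empty power_0)
      qed
      show ?thesis
      proof (cases "v d \<in> \<tau>")
        case False
        have "(\<Sum>u\<in>keys d - \<tau>. ksign u \<tau> * F d (insert u \<tau>))
            = (\<Sum>u\<in>keys d - \<tau>. if u = v d then koszul_coeff z d \<tau> else 0)"
          using False \<tau> s1[OF \<tau>] by (intro sum.cong) (auto simp: F_def)
        then show ?thesis using vd False by simp
      next
        case True
        let ?\<sigma> = "\<tau> - {v d}"
        have \<sigma>: "?\<sigma> \<subseteq> keys d" using \<tau> by auto
        have ks: "keys d - ?\<sigma> = insert (v d) (keys d - \<tau>)" using True vd by auto
        \<comment> \<open>The cycle condition at the face without \<open>v d\<close> can be solved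
          for the coefficient at \<tau>.\<close>
        have "0 = koszul_coeff (koszul_bdry z) d ?\<sigma>"
          by (simp add: cyc koszul_coeff_def)
        also have "\<dots> = koszul_coeff z d \<tau> + (\<Sum>u\<in>keys d - \<tau>. ksign u ?\<sigma> * koszul_coeff z d (insert u ?\<sigma>))"
          unfolding koszul_coeff_bdry[OF \<sigma>] ks using True s1[OF \<sigma>] by (simp add: insert_absorb)
        also have "(\<Sum>u\<in>keys d - \<tau>. ksign u ?\<sigma> * koszul_coeff z d (insert u ?\<sigma>))
            = (\<Sum>u\<in>keys d - \<tau>. - (ksign u \<tau> * F d (insert u \<tau>)))"
        proof (rule sum.cong[OF refl])
          fix u assume u: "u \<in> keys d - \<tau>"
          then have "to_nat (v d) \<noteq> to_nat u" using True by auto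
          then have "to_nat (v d) < to_nat u"
            using v(2)[OF \<open>d \<noteq> 0\<close>, of u] u by (simp add: order_less_le)
          then have "ksign u \<tau> = - (ksign u ?\<sigma> :: 'k)"
            using ksign_insert[of "v d" ?\<sigma> u] True by (simp add: insert_absorb)
          moreover have "insert u \<tau> - {v d} = insert u ?\<sigma>" using u True by auto
          ultimately show "ksign u ?\<sigma> * koszul_coeff z d (insert u ?\<sigma>) = - (ksign u \<tau> * F d (insert u \<tau>))"
            using True u \<tau> by (simp add: F_def)
        qed
        finally show ?thesis by (simp add: sum_negf)
      qed
    qed
    then show "koszul_coeff (koszul_bdry y) d \<tau> = koszul_coeff z d \<tau>"
      unfolding koszul_coeff_bdry[OF \<tau>] using \<tau> by (simp add: yc)
  qed
  ultimately show ?thesis by blast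
qed

text \<open>Supplies the cycle premise of \<open>koszul_exact\<close> in homological degree 0, so
  that this degree needs no separate exactness argument.\<close>

lemma koszul_bdry_degree_0:
  assumes "z \<in> term_tensor koszul 0 UNIV"
  shows "koszul_bdry z = 0"
proof (rule free_mod_eqI[OF keys_koszul_bdry])
  show "lookup (koszul_bdry z) (to_nat \<tau>) = lookup 0 (to_nat \<tau>)" for \<tau> :: "'a set"
  proof -
    have "lookup z (to_nat (insert u \<tau>)) = 0" for u
      using assms by (metis card_0_eq finite_code insert_not_empty koszul_term_iff)
    then show ?thesis by (simp add: lookup_koszul_bdry)
  qed
qed simp

definition koszul_aug :: "('n::finite, 'k::comm_ring_1) free_mod \<Rightarrow> 'k" where
  "koszul_aug z = lookup (lookup z (to_nat ({} :: 'n set))) 0"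

lemma koszul_aug_bdry: "koszul_aug (koszul_bdry z) = 0"
  using koszul_coeff_bdry[of "{}" 0 z] by (simp add: koszul_aug_def koszul_coeff_def)

lemma koszul_cycle_aug:
  assumes "z \<in> term_tensor koszul (Suc i) UNIV"
  shows "koszul_aug z = 0"
  using assms unfolding koszul_term_iff koszul_aug_def
  by (metis card.empty lookup_zero nat.distinct(1))

lemma resolves_koszul: "resolves_residue_field (koszul :: ('n::finite, 'k::comm_ring_1) graded_free_complex)"
proof -
  let ?K = "koszul :: ('n, 'k) graded_free_complex"
  have gm: "graded_map ?K (Suc i) ?K i koszul_bdry" for i
    by (rule graded_map_koszul_bdry)
  have ex: "koszul_bdry z = 0 \<longleftrightarrow> z \<in> koszul_bdry ` term_tensor ?K (Suc (Suc i)) UNIV"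
    if z: "z \<in> term_tensor ?K (Suc i) UNIV" for i and z :: "('n, 'k) free_mod"
  proof
    assume "koszul_bdry z = 0"
    then obtain y where "y \<in> term_tensor ?K (Suc (Suc i)) UNIV" "koszul_bdry y = z"
      using koszul_exact[OF z] koszul_cycle_aug[OF z] by (auto simp: koszul_aug_def)
    then show "z \<in> koszul_bdry ` term_tensor ?K (Suc (Suc i)) UNIV" by blast
  qed (auto simp: koszul_bdry_bdry)
  have hom: "module_hom smult_free smult_residue (koszul_aug :: ('n, 'k) free_mod \<Rightarrow> 'k)"
    by (intro module_hom.intro module_hom_axioms.intro module_smult_free module_smult_residue)
      (simp_all add: koszul_aug_def lookup_add lookup_smult_free lookup_mult_zero smult_residue_def)
  have deg: "koszul_aug z = 0"
    if "free_homogeneous ?K 0 a z" "a \<noteq> (\<lambda>_. 0)" for a and z :: "('n, 'k) free_mod"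
  proof (rule ccontr)
    assume "koszul_aug z \<noteq> 0"
    then have 0: "0 \<in> keys (lookup z (to_nat ({} :: 'n set)))"
      by (simp add: koszul_aug_def in_keys_iff)
    have "mhomogeneous (\<lambda>v. a v - of_bool (v \<in> {})) (lookup z (to_nat ({} :: 'n set)))"
      using that(1) card.empty unfolding koszul_homogeneous_iff by blast
    then have "a v = 0" for v
      using 0 by (auto simp: mhomogeneous_def)
    then show False using that(2) by auto
  qed
  have surj: "koszul_aug ` term_tensor ?K 0 UNIV = UNIV"
  proof -
    have "c \<in> koszul_aug ` term_tensor ?K 0 UNIV" for c
    proof (rule image_eqI)
      show "c = koszul_aug (single (to_nat ({} :: 'n set)) (single 0 c) :: ('n, 'k) free_mod)"
        by (simp add: koszul_aug_def)
    qed (auto simp: term_tensor_UNIV)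
    then show ?thesis by blast
  qed
  have ex0: "koszul_aug z = 0 \<longleftrightarrow> z \<in> koszul_bdry ` term_tensor ?K 1 UNIV"
    if z: "z \<in> term_tensor ?K 0 UNIV" for z :: "('n, 'k) free_mod"
  proof
    assume "koszul_aug z = 0"
    then obtain y where "y \<in> term_tensor ?K (Suc 0) UNIV" "koszul_bdry y = z"
      using koszul_exact[OF z koszul_bdry_degree_0[OF z]] unfolding koszul_aug_def by blast
    then show "z \<in> koszul_bdry ` term_tensor ?K 1 UNIV" by auto
  qed (auto simp: koszul_aug_bdry)
  show ?thesis
    unfolding resolves_residue_field_def koszul_simps
  proof (intro conjI allI ballI impI exI[of _ koszul_aug])
    show "module_hom smult_free smult_free (koszul_bdry :: ('n, 'k) free_mod \<Rightarrow> _)"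
      by (rule graded_map_hom[OF gm])
    show "koszul_bdry ` term_tensor ?K (Suc i) UNIV \<subseteq> term_tensor ?K i UNIV" for i
      using graded_map_UNIV[OF gm] by blast
    fix z :: "('n, 'k) free_mod"
    show "free_homogeneous ?K i a (koszul_bdry z)"
      if "z \<in> term_tensor ?K (Suc i) UNIV" "free_homogeneous ?K (Suc i) a z" for i a
      using graded_map_homogeneous[OF gm that] .
    show "koszul_bdry z = 0 \<longleftrightarrow> z \<in> koszul_bdry ` term_tensor ?K (Suc (Suc i)) UNIV"
      if "z \<in> term_tensor ?K (Suc i) UNIV" for i
      using ex[OF that] .
    show "koszul_aug z = 0" if "free_homogeneous ?K 0 a z \<and> a \<noteq> (\<lambda>_. 0)" for a
      using deg that by blast
    show "koszul_aug z = 0 \<longleftrightarrow> z \<in> koszul_bdry ` term_tensor ?K 1 UNIV" if "z \<in> term_tensor ?K 0 UNIV"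
      using ex0[OF that] .
  qed (fact hom surj)+
qed

section \<open>The top Tor group\<close>

lemma term_tensor_top:
  fixes z :: "('n::finite, 'k::comm_ring_1) free_mod"
  assumes "z \<in> term_tensor koszul CARD('n) UNIV"
  shows "z = single (to_nat (UNIV :: 'n set)) (lookup z (to_nat (UNIV :: 'n set)))"
proof (rule free_mod_eqI)
  show "keys z \<subseteq> range (to_nat :: 'n set \<Rightarrow> nat)"
    using assms by (simp add: koszul_term_iff)
  show "keys (single (to_nat (UNIV :: 'n set)) (lookup z (to_nat (UNIV :: 'n set)))) \<subseteq> range (to_nat :: 'n set \<Rightarrow> nat)"
    by simp
  fix \<tau> :: "'n set"
  have "lookup z (to_nat \<tau>) = 0" if "\<tau> \<noteq> UNIV"
    using assms that card_subset_eq[of "UNIV :: 'n set" \<tau>] unfolding koszul_term_iff by auto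
  then show "lookup z (to_nat \<tau>) = lookup (single (to_nat (UNIV :: 'n set)) (lookup z (to_nat (UNIV :: 'n set)))) (to_nat \<tau>)"
    by (auto simp: lookup_single when_def)
qed

lemma term_tensor_above_top:
  fixes z :: "('n::finite, 'k::comm_ring_1) free_mod"
  assumes "z \<in> term_tensor koszul (Suc CARD('n)) UNIV"
  shows "z = 0"
proof (rule free_mod_eqI)
  show "keys z \<subseteq> range (to_nat :: 'n set \<Rightarrow> nat)"
    using assms by (simp add: koszul_term_iff)
  fix \<tau> :: "'n set"
  have "card \<tau> \<noteq> Suc CARD('n)"
    using card_mono[of "UNIV :: 'n set" \<tau>] by simp
  then show "lookup z (to_nat \<tau>) = lookup 0 (to_nat \<tau>)"
    using assms unfolding koszul_term_iff by auto
qed simp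

lemma koszul_bdry_top:
  fixes f :: "('n::finite, 'k::comm_ring_1) mpoly" and \<tau> :: "'n set"
  defines "y \<equiv> single (to_nat (UNIV :: 'n set)) f"
  shows "lookup (koszul_bdry y) (to_nat (- {v} :: 'n set)) = ksign v (- {v}) * (xvar v * f)"
    and "(\<And>v. \<tau> \<noteq> - {v}) \<Longrightarrow> lookup (koszul_bdry y) (to_nat \<tau>) = 0"
proof -
  have "insert v (- {v}) = (UNIV :: 'n set)" by auto
  then show "lookup (koszul_bdry y) (to_nat (- {v} :: 'n set)) = ksign v (- {v}) * (xvar v * f)"
    by (simp add: lookup_koszul_bdry y_def)
next
  assume "\<And>v. \<tau> \<noteq> - {v}"
  then have "insert u \<tau> \<noteq> UNIV" if "u \<notin> \<tau>" for u
    using that by (metis Compl_insert Compl_UNIV_eq Diff_insert_absorb double_complement Compl_eq_Diff_UNIV)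
  then show "lookup (koszul_bdry y) (to_nat \<tau>) = 0"
    unfolding lookup_koszul_bdry y_def by (intro sum.neutral) (auto simp: lookup_single when_def)
qed

text \<open>A cycle of \<open>K\<^sub>n\<^sub>-\<^sub>1 \<otimes> J\<close> is the boundary of some \<open>f e\<^sub>1 \<and> \<dots> \<and> e\<^sub>n\<close> with \<open>f \<in> S\<close>; the boundary has
  coefficients in \<open>J\<close> iff every \<open>x\<^sub>v f\<close> is in \<open>J\<close>. For \<open>n = 1\<close> every element of \<open>K\<^sub>0 \<otimes> J\<close> counts as a
  cycle, which is why \<open>J\<close> has to be proper.\<close>

lemma Tor_nonzero_top_iff:
  fixes J :: "('n::finite, 'k::field) mpoly set"
  assumes J: "is_ideal J" and proper: "1 \<notin> J"
  shows "Tor_nonzero (CARD('n) - 1) J a \<longleftrightarrow>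
    (\<exists>m. a = (\<lambda>v. int (lookup m v) + 1) \<and> xmonom m \<notin> J \<and> (\<forall>v. xvar v * xmonom m \<in> J))"
proof -
  let ?K = "koszul :: ('n, 'k) graded_free_complex" and ?i = "CARD('n) - 1"
  let ?e = "single (to_nat (UNIV :: 'n set)) :: _ \<Rightarrow> ('n, 'k) free_mod"
  have Suc_i: "Suc ?i = CARD('n)" by simp
  have gm: "graded_map ?K CARD('n) ?K ?i koszul_bdry"
    using graded_map_koszul_bdry[of ?i] Suc_i by metis
  have sub: "tor_boundaries ?K ?i J a \<subseteq> tor_cycles ?K ?i J a"
    by (rule tor_boundaries_subset[OF resolves_koszul J])
  have eterm: "?e f \<in> term_tensor ?K CARD('n) UNIV" for f
    by (auto simp: term_tensor_UNIV)
  have eJ: "?e f \<in> term_tensor ?K CARD('n) J \<longleftrightarrow> f \<in> J" for f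
    using eterm ring_mod.subspace_0[OF J] by (auto simp: term_tensor_iff[OF J] term_tensor_UNIV lookup_single when_def)
  have ehom: "free_homogeneous ?K CARD('n) a (?e f) \<longleftrightarrow> mhomogeneous (\<lambda>v. a v - 1) f" for f
  proof -
    have "card \<tau> = CARD('n) \<longleftrightarrow> \<tau> = UNIV" for \<tau> :: "'n set"
      using card_subset_eq[of "UNIV :: 'n set" \<tau>] by auto
    then show ?thesis by (simp add: koszul_homogeneous_iff)
  qed
  have dJ: "koszul_bdry (?e f) \<in> term_tensor ?K ?i J \<longleftrightarrow> (\<forall>v. xvar v * f \<in> J)" for f
  proof
    assume "koszul_bdry (?e f) \<in> term_tensor ?K ?i J"
    then have "lookup (koszul_bdry (?e f)) (to_nat (- {v} :: 'n set)) \<in> J" for v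
      by (simp add: term_tensor_iff[OF J])
    then show "\<forall>v. xvar v * f \<in> J"
      unfolding koszul_bdry_top(1) ksign_mult_mem_iff[OF J] by blast
  next
    assume *: "\<forall>v. xvar v * f \<in> J"
    have "lookup (koszul_bdry (?e f)) (to_nat \<tau>) \<in> J" for \<tau> :: "'n set"
    proof (cases "\<exists>v. \<tau> = - {v}")
      case True
      then obtain v where "\<tau> = - {v}" by blast
      moreover have "lookup (koszul_bdry (?e f)) (to_nat (- {v})) \<in> J"
        unfolding koszul_bdry_top(1) ksign_mult_mem_iff[OF J] using * by blast
      ultimately show ?thesis by simp
    next
      case False
      then show ?thesis
        using koszul_bdry_top(2)[of \<tau> f] ring_mod.subspace_0[OF J] by simp
    qed
    then have "\<forall>b \<in> basis ?K ?i. lookup (koszul_bdry (?e f)) b \<in> J"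
      by auto
    then show "koszul_bdry (?e f) \<in> term_tensor ?K ?i J"
      using graded_map_UNIV[OF gm eterm] unfolding term_tensor_def by blast
  qed
  have "tor_cycles ?K ?i J a \<noteq> tor_boundaries ?K ?i J a \<longleftrightarrow>
    (\<exists>m. a = (\<lambda>v. int (lookup m v) + 1) \<and> xmonom m \<notin> J \<and> (\<forall>v. xvar v * xmonom m \<in> J))"
  proof
    assume "tor_cycles ?K ?i J a \<noteq> tor_boundaries ?K ?i J a"
    then obtain z where zc: "z \<in> tor_cycles ?K ?i J a" and zb: "z \<notin> tor_boundaries ?K ?i J a"
      using sub by blast
    then have z: "z \<in> term_tensor ?K ?i J" "free_homogeneous ?K ?i a z" "?i = 0 \<or> koszul_bdry z = 0"
      by (auto simp: tor_cycles_def)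
    note zt = term_tensor_mono[OF z(1)]
    have "koszul_bdry z = 0"
      using z(3) koszul_bdry_degree_0 zt by metis
    moreover have "koszul_aug z = 0"
    proof (cases ?i)
      case (Suc j)
      then show ?thesis using zt koszul_cycle_aug by metis
    next
      \<comment> \<open>Here n = 1. By homogeneity, a coefficient with nonzero constant term is a
        constant, hence a unit lying in \<open>J\<close>.\<close>
      case 0
      show ?thesis
      proof (rule ccontr)
        assume nz: "koszul_aug z \<noteq> 0"
        let ?p = "lookup z (to_nat ({} :: 'n set))"
        have p0: "0 \<in> keys ?p" using nz by (simp add: koszul_aug_def in_keys_iff)
        have "mhomogeneous (\<lambda>v. a v - of_bool (v \<in> {})) ?p"
          using z(2) 0 card.empty unfolding koszul_homogeneous_iff by metis
        then have p: "mhomogeneous a ?p" by simp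
        have "m = 0" if "m \<in> keys ?p" for m
        proof (rule poly_mapping_eqI)
          fix v
          have "int (lookup m v) = int (lookup 0 v)"
            using p p0 that unfolding mhomogeneous_def by metis
          then show "lookup m v = lookup 0 v" by simp
        qed
        then have "?p = single 0 (koszul_aug z)"
          by (intro poly_mapping_eqI) (auto simp: koszul_aug_def lookup_single when_def in_keys_iff)
        then have "single 0 (inverse (koszul_aug z)) * ?p = 1"
          using nz by (simp add: mult_single)
        moreover have "?p \<in> J" using z(1) by (simp add: term_tensor_iff[OF J])
        ultimately show False
          using ideal_mult_right[OF J] proper by metis
      qed
    qed
    ultimately obtain y' where y': "y' \<in> term_tensor ?K CARD('n) UNIV" "koszul_bdry y' = z"
      using koszul_exact[OF zt] Suc_i by (auto simp: koszul_aug_def)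
    \<comment> \<open>\<open>tor_boundaries\<close> only admits homogeneous preimages, so the
      preimage is cut down to degree \<open>a\<close>.\<close>
    define y where "y = free_comp ?K CARD('n) a y'"
    have y: "y \<in> term_tensor ?K CARD('n) UNIV" "free_homogeneous ?K CARD('n) a y"
      unfolding y_def using y'(1) by (auto intro: free_comp_term free_comp_homogeneous)
    have yz: "koszul_bdry y = z"
      using graded_map_comp_commute[OF gm y'(1), of a] free_comp_of_homogeneous[OF zt z(2), of a] y'(2)
      by (simp add: y_def)
    define f where "f = lookup y (to_nat (UNIV :: 'n set))"
    have yf: "y = ?e f" unfolding f_def by (rule term_tensor_top[OF y(1)])
    have f: "mhomogeneous (\<lambda>v. a v - 1) f" using y(2) yf ehom by simp
    have fJ: "f \<notin> J"
    proof
      assume "f \<in> J"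
      then have "y \<in> term_tensor ?K (Suc ?i) J" using yf eJ by simp
      then show False
        using zb y(2) yz by (auto simp: tor_boundaries_def)
    qed
    then have "f \<noteq> 0" using ring_mod.subspace_0[OF J] by auto
    then obtain m where m: "m \<in> keys f"
      by (metis poly_mapping_eqI in_keys_iff lookup_zero)
    \<comment> \<open>In the fine grading each degree contains at most one monomial, so
      \<open>f\<close> is a scalar multiple of \<open>xmonom m\<close>.\<close>
    have "m' = m" if "m' \<in> keys f" for m'
    proof (rule poly_mapping_eqI)
      fix v
      have "int (lookup m' v) = int (lookup m v)"
        using f m that unfolding mhomogeneous_def by metis
      then show "lookup m' v = lookup m v" by simp
    qed
    then have fm: "f = single m (lookup f m)"
      by (intro poly_mapping_eqI) (auto simp: lookup_single when_def in_keys_iff)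
    have c: "lookup f m \<noteq> 0" using m by (simp add: in_keys_iff)
    have scale: "xmonom m = single 0 (inverse (lookup f m)) * f"
      using c by (subst (2) fm) (simp add: mult_single xmonom_def)
    have "f = single 0 (lookup f m) * xmonom m"
      by (subst fm) (simp add: mult_single xmonom_def)
    then have "xmonom m \<notin> J"
      using fJ ideal_mult_right[OF J] by metis
    moreover have "xvar v * xmonom m \<in> J" for v
    proof -
      have "xvar v * f \<in> J"
        using dJ[of f] z(1) yf yz by simp
      then show ?thesis
        unfolding scale mult.left_commute[of "xvar v"] by (rule ideal_mult_right[OF J])
    qed
    moreover have "a = (\<lambda>v. int (lookup m v) + 1)"
      using f m by (auto simp: mhomogeneous_def fun_eq_iff)
    ultimately show "\<exists>m. a = (\<lambda>v. int (lookup m v) + 1) \<and> xmonom m \<notin> J \<and> (\<forall>v. xvar v * xmonom m \<in> J)"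
      by blast
  next
    assume "\<exists>m. a = (\<lambda>v. int (lookup m v) + 1) \<and> xmonom m \<notin> J \<and> (\<forall>v. xvar v * xmonom m \<in> J)"
    then obtain m where m: "a = (\<lambda>v. int (lookup m v) + 1)" "xmonom m \<notin> J" "\<forall>v. xvar v * xmonom m \<in> J"
      by blast
    let ?y = "?e (xmonom m)"
    have "free_homogeneous ?K CARD('n) a ?y"
      unfolding ehom by (auto simp: m(1) mhomogeneous_def xmonom_def)
    then have cyc: "koszul_bdry ?y \<in> tor_cycles ?K ?i J a"
      using dJ m(3) graded_map_homogeneous[OF gm eterm] by (simp add: tor_cycles_def koszul_bdry_bdry)
    moreover have "koszul_bdry ?y \<notin> tor_boundaries ?K ?i J a"
    proof
      assume "koszul_bdry ?y \<in> tor_boundaries ?K ?i J a"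
      then obtain x where x: "x \<in> term_tensor ?K CARD('n) J" "koszul_bdry ?y = koszul_bdry x"
        using Suc_i by (auto simp: tor_boundaries_def)
      \<comment> \<open>The top differential is injective, because the complex is zero one step
        above it. So a preimage with coefficients in \<open>J\<close> would have to be
        \<open>?y\<close> itself.\<close>
      have d: "?y - x \<in> term_tensor ?K CARD('n) UNIV"
        using eterm term_tensor_mono[OF x(1)] by (intro free_mod.subspace_diff[OF term_tensor_subspace]) auto
      moreover have "koszul_bdry (?y - x) = 0"
        using module_hom.diff[OF graded_map_hom[OF gm]] x(2) by simp
      moreover have "koszul_aug (?y - x) = 0"
        using d Suc_i koszul_cycle_aug by metis
      ultimately obtain w where "w \<in> term_tensor ?K (Suc CARD('n)) UNIV" "koszul_bdry w = ?y - x"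
        using koszul_exact by (auto simp: koszul_aug_def)
      then have "?y - x = 0"
        using term_tensor_above_top module_hom.zero[OF graded_map_hom[OF gm]] by metis
      then have "?y = x" by simp
      then have "?y \<in> term_tensor ?K CARD('n) J" using x(1) by (simp only:)
      then show False
        using eJ m(2) by simp
    qed
    ultimately show "tor_cycles ?K ?i J a \<noteq> tor_boundaries ?K ?i J a"
      by blast
  qed
  then show ?thesis
    using Tor_nonzero_iff[OF resolves_koszul J] by metis
qed

section \<open>Sums of edges\<close>

definition edge_msets :: "('n \<Rightarrow> 'n \<Rightarrow> bool) \<Rightarrow> 'n multiset set" where
  "edge_msets E = {{#u, v#} | u v. E u v}"

text \<open>The exponent vectors of the generators of \<open>I(G)\<^sup>k\<close>.\<close>

definition edge_sums :: "('n \<Rightarrow> 'n \<Rightarrow> bool) \<Rightarrow> nat \<Rightarrow> 'n multiset set" where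
  "edge_sums E k = {\<Sum>\<^sub># M | M. set_mset M \<subseteq> edge_msets E \<and> size M = k}"

lemma edge_sumsI: "set_mset M \<subseteq> edge_msets E \<Longrightarrow> size M = k \<Longrightarrow> \<Sum>\<^sub># M \<in> edge_sums E k"
  by (auto simp: edge_sums_def)

lemma edge_sumsE:
  assumes "s \<in> edge_sums E k"
  obtains M where "set_mset M \<subseteq> edge_msets E" "size M = k" "s = \<Sum>\<^sub># M"
  using assms by (auto simp: edge_sums_def)

lemma edge_msetI: "E u v \<Longrightarrow> {#u, v#} \<in> edge_msets E"
  by (auto simp: edge_msets_def)

lemma edge_sums_0: "edge_sums E 0 = {{#}}"
  by (auto simp: edge_sums_def)

lemma edge_sums_Suc: "edge_sums E (Suc k) = {e + s | e s. e \<in> edge_msets E \<and> s \<in> edge_sums E k}"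
proof (intro set_eqI iffI)
  fix t assume "t \<in> edge_sums E (Suc k)"
  then obtain M where M: "set_mset M \<subseteq> edge_msets E" "size M = Suc k" "t = \<Sum>\<^sub># M"
    by (rule edge_sumsE)
  then obtain e M' where "M = add_mset e M'"
    by (metis size_eq_Suc_imp_eq_union)
  then have "t = e + \<Sum>\<^sub># M'" "e \<in> edge_msets E" "\<Sum>\<^sub># M' \<in> edge_sums E k"
    using M by (auto intro: edge_sumsI)
  then show "t \<in> {e + s | e s. e \<in> edge_msets E \<and> s \<in> edge_sums E k}"
    by blast
next
  fix t assume "t \<in> {e + s | e s. e \<in> edge_msets E \<and> s \<in> edge_sums E k}"
  then obtain e M where "e \<in> edge_msets E" "set_mset M \<subseteq> edge_msets E" "size M = k" "t = e + \<Sum>\<^sub># M"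
    by (auto elim!: edge_sumsE)
  then show "t \<in> edge_sums E (Suc k)"
    using edge_sumsI[of "add_mset e M" E "Suc k"] by simp
qed

lemma edge_sums_add_edge: "s \<in> edge_sums E k \<Longrightarrow> E u v \<Longrightarrow> {#u, v#} + s \<in> edge_sums E (Suc k)"
  unfolding edge_sums_Suc
  by (rule CollectI, rule exI[of _ "{#u, v#}"], rule exI[of _ s]) (simp add: edge_msetI)

lemma size_edge_sums: "s \<in> edge_sums E k \<Longrightarrow> size s = 2 * k"
proof (induction k arbitrary: s)
  case 0
  then show ?case by (simp add: edge_sums_0)
next
  case (Suc k)
  then show ?case by (auto simp: edge_sums_Suc edge_msets_def)
qed

lemma edge_at_vertex:
  assumes "symp E" "set_mset M \<subseteq> edge_msets E" "v \<in># \<Sum>\<^sub># M"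
  obtains w M' where "E v w" "M = add_mset {#v, w#} M'"
proof -
  from assms(3) obtain e where e: "e \<in># M" "v \<in># e" by (auto simp: in_Union_mset_iff)
  then obtain x y where "e = {#x, y#}" "E x y"
    using assms(2) by (auto simp: edge_msets_def)
  then obtain w where "e = {#v, w#}" "E v w"
    using e(2) assms(1) by (auto simp: add_mset_commute dest: sympD)
  then show ?thesis
    using e(1) that by (metis insert_DiffM)
qed

text \<open>Follow an alternating trail that starts at \<open>v\<close> with an edge of \<open>M\<close> and uses edges of \<open>M\<close> and
  \<open>N\<close> in turn, until it reaches a vertex at which the other multiset has the larger degree.\<close>

lemma alternating_exchange:
  assumes E: "symp E" "irreflp E"
    and "set_mset M \<subseteq> edge_msets E" "set_mset N \<subseteq> edge_msets E"
    and "count (\<Sum>\<^sub># N) v < count (\<Sum>\<^sub># M) v"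
  shows "(\<exists>z t. count (\<Sum>\<^sub># M) z < count (\<Sum>\<^sub># N) z \<and> t \<in> edge_sums E (size M) \<and>
            add_mset v t = add_mset z (\<Sum>\<^sub># M)) \<or>
         (\<exists>z t. t \<in> edge_sums E (Suc (size N)) \<and> t = \<Sum>\<^sub># N + {#v, z#} \<and> t \<subseteq># \<Sum>\<^sub># M \<union># \<Sum>\<^sub># N)"
  using assms(3-)
proof (induction "size M" arbitrary: M N v rule: less_induct)
  case less
  from less.prems(3) have "v \<in># \<Sum>\<^sub># M"
    by (metis count_greater_zero_iff gr_zeroI not_less_zero)
  then obtain q M' where q: "E v q" and M: "M = add_mset {#v, q#} M'"
    using edge_at_vertex[OF E(1) less.prems(1)] by blast
  have qv: "q \<noteq> v" using q E(2) by (auto dest: irreflpD)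
  have M': "set_mset M' \<subseteq> edge_msets E" using less.prems(1) M by auto
  have NE: "\<Sum>\<^sub># N \<in> edge_sums E (size N)" using less.prems(2) by (rule edge_sumsI) simp
  show ?case
  proof (cases "count (\<Sum>\<^sub># N) q < count (\<Sum>\<^sub># M) q")
    case True
    let ?t = "\<Sum>\<^sub># N + {#v, q#}"
    have "?t \<in> edge_sums E (Suc (size N))"
      using edge_sums_add_edge[OF NE q] by (simp add: add.commute)
    moreover have "?t \<subseteq># \<Sum>\<^sub># M \<union># \<Sum>\<^sub># N"
      using True less.prems(3) qv by (intro mset_subset_eqI) auto
    ultimately show ?thesis by blast
  next
    case False
    \<comment> \<open>As \<open>M\<close> has no surplus at \<open>q\<close> but does have an edge
      there, \<open>N\<close> has one too and the trail continues.\<close>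
    have "q \<in># \<Sum>\<^sub># M" by (simp add: M)
    then have "q \<in># \<Sum>\<^sub># N" using False by (metis count_greater_zero_iff not_gr_zero)
    then obtain p N' where p: "E q p" and N: "N = add_mset {#q, p#} N'"
      using edge_at_vertex[OF E(1) less.prems(2)] by blast
    have pq: "p \<noteq> q" using p E(2) by (auto dest: irreflpD)
    have N': "set_mset N' \<subseteq> edge_msets E" using less.prems(2) N by auto
    show ?thesis
    proof (cases "count (\<Sum>\<^sub># M) p < count (\<Sum>\<^sub># N) p")
      case True
      let ?t = "{#q, p#} + \<Sum>\<^sub># M'"
      have "?t \<in> edge_sums E (size M)"
        using edge_sums_add_edge[OF edge_sumsI[OF M' refl] p] by (simp add: M)
      moreover have "add_mset v ?t = add_mset p (\<Sum>\<^sub># M)"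
        by (simp add: M)
      ultimately show ?thesis using True by blast
    next
      case False
      have cM: "count (\<Sum>\<^sub># M) x = count (\<Sum>\<^sub># M') x + of_bool (x = v) + of_bool (x = q)" for x
        by (simp add: M)
      have cN: "count (\<Sum>\<^sub># N) x = count (\<Sum>\<^sub># N') x + of_bool (x = q) + of_bool (x = p)" for x
        by (simp add: N)
      have vN: "count (\<Sum>\<^sub># N) v < count (\<Sum>\<^sub># M) v" by (rule less.prems(3))
      \<comment> \<open>Deleting the two edges hands the surplus of \<open>M\<close> on from
        \<open>v\<close> to \<open>p\<close>. If \<open>p = v\<close>, both degrees drop by one and
        the surplus stays.\<close>
      have p': "count (\<Sum>\<^sub># N') p < count (\<Sum>\<^sub># M') p"
        using False vN pq cM[of p] cN[of p] cM[of v] cN[of v] qv by (cases "p = v") auto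
      have "size M' < size M" by (simp add: M)
      from less.hyps[OF this M' N' p'] show ?thesis
      proof (elim disjE exE conjE)
        fix z t assume z: "count (\<Sum>\<^sub># M') z < count (\<Sum>\<^sub># N') z" and t: "t \<in> edge_sums E (size M')"
          and eq: "add_mset p t = add_mset z (\<Sum>\<^sub># M')"
        have "{#q, p#} + t \<in> edge_sums E (size M)"
          using edge_sums_add_edge[OF t p] by (simp add: M)
        moreover have "add_mset v ({#q, p#} + t) = add_mset z (\<Sum>\<^sub># M)"
          using eq by (simp add: M add_mset_commute)
        moreover have "count (\<Sum>\<^sub># M) z < count (\<Sum>\<^sub># N) z"
          using z p' vN cM[of z] cN[of z] qv by (cases "z = v"; cases "z = p") auto
        ultimately show ?thesis by blast
      next
        fix z t assume t: "t \<in> edge_sums E (Suc (size N'))" "t = \<Sum>\<^sub># N' + {#p, z#}"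
          "t \<subseteq># \<Sum>\<^sub># M' \<union># \<Sum>\<^sub># N'"
        let ?t = "\<Sum>\<^sub># N + {#v, z#}"
        \<comment> \<open>The edge \<open>{#v, q#}\<close> takes the place of
          \<open>{#q, p#}\<close>, so the degrees are again those of \<open>N\<close> plus the two
          ends of the trail.\<close>
        have "{#v, q#} + t = ?t" by (simp add: t(2) N add_mset_commute)
        then have "?t \<in> edge_sums E (Suc (size N))"
          using edge_sums_add_edge[OF t(1) q] by (simp only: N size_add_mset)
        moreover have "?t \<subseteq># \<Sum>\<^sub># M \<union># \<Sum>\<^sub># N"
        proof (rule mset_subset_eqI)
          fix x
          have "count t x \<le> max (count (\<Sum>\<^sub># M') x) (count (\<Sum>\<^sub># N') x)"
            using mset_subset_eq_count[OF t(3)] by simp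
          then show "count ?t x \<le> count (\<Sum>\<^sub># M \<union># \<Sum>\<^sub># N) x"
            using vN cM[of x] cN[of x] qv pq
            by (cases "x = v"; cases "x = z"; cases "x = p"; cases "x = q")
              (auto simp: t(2) max_def split: if_splits)
        qed
        ultimately show ?thesis by blast
      qed
    qed
  qed
qed

section \<open>Socle degrees\<close>

text \<open>\<open>a \<in> socle_degrees E k\<close> means that the monomial with exponent vector \<open>a\<close> spans a socle
  element of \<open>S/I(G)\<^sup>k\<close>.\<close>

definition socle_degrees :: "('n \<Rightarrow> 'n \<Rightarrow> bool) \<Rightarrow> nat \<Rightarrow> 'n multiset set" where
  "socle_degrees E k = {a. (\<forall>s \<in> edge_sums E k. \<not> s \<subseteq># a) \<and> (\<forall>v. \<exists>s \<in> edge_sums E k. s \<subseteq># add_mset v a)}"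

section \<open>Gallai's lemma with vertex capacities\<close>

context
  fixes E :: "'n \<Rightarrow> 'n \<Rightarrow> bool" and a :: "'n multiset" and j :: nat
  assumes E: "symp E" "irreflp E" and a: "a \<in> socle_degrees E (Suc j)"
begin

lemma not_edge_sum_below: "s \<in> edge_sums E (Suc j) \<Longrightarrow> \<not> s \<subseteq># a"
  using a by (auto simp: socle_degrees_def)

text \<open>With \<open>a\<close> as vertex capacities, \<open>edge_sums E j\<close> below \<open>a\<close> are the degrees of the maximum
  matchings.\<close>

definition deficient :: "'n set" where
  "deficient = {v. \<exists>s \<in> edge_sums E j. add_mset v s \<subseteq># a}"

definition jointly_covered :: "'n \<Rightarrow> 'n \<Rightarrow> bool" where
  "jointly_covered u v \<longleftrightarrow> (\<forall>s \<in> edge_sums E j. \<not> s + {#u, v#} \<subseteq># a)"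

text \<open>A sum of \<open>j + 1\<close> edges below \<open>a\<close> plus \<open>v\<close> must
  use \<open>v\<close>, as it does not fit into \<open>a\<close>. Deleting one of its edges at
  \<open>v\<close> leaves the other end of that edge unsaturated.\<close>

lemma deficient_neighbour: "\<exists>w \<in> deficient. E v w"
proof -
  obtain s where s: "s \<in> edge_sums E (Suc j)" "s \<subseteq># add_mset v a"
    using a by (auto simp: socle_degrees_def)
  then obtain M where M: "set_mset M \<subseteq> edge_msets E" "size M = Suc j" "s = \<Sum>\<^sub># M"
    by (auto elim: edge_sumsE)
  have "v \<in># \<Sum>\<^sub># M"
  proof (rule ccontr)
    assume "v \<notin># \<Sum>\<^sub># M"
    then have "s \<subseteq># a"
      using s(2) M(3) by (metis diff_single_trivial subset_eq_diff_conv add_mset_add_single)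
    then show False using not_edge_sum_below s(1) by blast
  qed
  then obtain w M' where w: "E v w" "M = add_mset {#v, w#} M'"
    using edge_at_vertex[OF E(1) M(1)] by blast
  have "\<Sum>\<^sub># M' \<in> edge_sums E j" using M w by (intro edge_sumsI) auto
  moreover have "add_mset w (\<Sum>\<^sub># M') \<subseteq># a" using s(2) M(3) w(2) by simp
  ultimately show ?thesis using w(1) by (auto simp: deficient_def)
qed

text \<open>Otherwise the edge between the two could be added, giving \<open>j + 1\<close> edges
  below \<open>a\<close>.\<close>

lemma adjacent_jointly_covered:
  assumes "E u v"
  shows "jointly_covered u v"
  unfolding jointly_covered_def
proof
  fix s assume "s \<in> edge_sums E j"
  then have "{#u, v#} + s \<in> edge_sums E (Suc j)"
    using assms by (rule edge_sums_add_edge)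
  then show "\<not> s + {#u, v#} \<subseteq># a"
    using not_edge_sum_below by (metis add.commute)
qed

lemma jointly_covered_sym: "jointly_covered u v \<Longrightarrow> jointly_covered v u"
  by (simp add: jointly_covered_def add_mset_commute)

text \<open>Suppose \<open>s1\<close> leaves \<open>u\<close> and \<open>w\<close> free and
  \<open>s2\<close> leaves \<open>v\<close> free. An exchange from \<open>v\<close> frees
  \<open>v\<close> in \<open>s1\<close> and fills one vertex, hence at most one of the two free
  places: \<open>v\<close> is then free together with \<open>u\<close> or \<open>w\<close>. The
  other outcome of the exchange is a matching larger than the maximum.\<close>

lemma jointly_covered_trans:
  assumes v: "v \<in> deficient" and uv: "jointly_covered u v" and vw: "jointly_covered v w"
  shows "jointly_covered u w"
  unfolding jointly_covered_def
proof (intro ballI notI)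
  fix s1 assume s1: "s1 \<in> edge_sums E j" and s1a: "s1 + {#u, w#} \<subseteq># a"
  obtain s2 where s2: "s2 \<in> edge_sums E j" and s2a: "add_mset v s2 \<subseteq># a"
    using v by (auto simp: deficient_def)
  have c1: "count s1 x + of_bool (x = u) + of_bool (x = w) \<le> count a x" for x
    using mset_subset_eq_count[OF s1a, of x] by (auto split: if_splits)
  have c2: "count s2 x + of_bool (x = v) \<le> count a x" for x
    using mset_subset_eq_count[OF s2a, of x] by (auto split: if_splits)
  have no: "\<not> t + {#u, v#} \<subseteq># a" "\<not> t + {#v, w#} \<subseteq># a" if "t \<in> edge_sums E j" for t
    using uv vw that by (auto simp: jointly_covered_def)
  \<comment> \<open>\<open>s1\<close> saturates \<open>v\<close>: otherwise it would leave
    \<open>u\<close> and \<open>v\<close> free, or \<open>v\<close> and \<open>w\<close> in case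
    \<open>u = v\<close>.\<close>
  have "count a v \<le> count s1 v"
  proof (rule ccontr)
    assume less: "\<not> count a v \<le> count s1 v"
    show False
    proof (cases "u = v")
      case True
      then show False using no(2)[OF s1] s1a by simp
    next
      case False
      have "count (s1 + {#u, v#}) x \<le> count a x" for x
        using c1[of x] less False by auto
      then show False using no(1)[OF s1] by (meson mset_subset_eqI)
    qed
  qed
  then have less: "count s2 v < count s1 v"
    using c2[of v] by simp
  obtain M N where M: "set_mset M \<subseteq> edge_msets E" "size M = j" "s1 = \<Sum>\<^sub># M"
    and N: "set_mset N \<subseteq> edge_msets E" "size N = j" "s2 = \<Sum>\<^sub># N"
    using s1 s2 by (metis edge_sumsE)
  from alternating_exchange[OF E M(1) N(1), folded M(3) N(3), unfolded M(2) N(2), OF less] show False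
  proof (elim disjE exE conjE)
    fix z t assume z: "count s1 z < count s2 z" and t: "t \<in> edge_sums E j" "add_mset v t = add_mset z s1"
    have ct: "count t x + of_bool (x = v) = count s1 x + of_bool (x = z)" for x
      using arg_cong[OF t(2), of "\<lambda>m. count m x"] by (simp split: if_splits)
    show False
    proof (cases "z = u")
      case True
      then have "t + {#v, w#} = s1 + {#u, w#}" using t(2) by (simp add: add_mset_commute)
      then show False using no(2)[OF t(1)] s1a by metis
    next
      case False
      have "count (t + {#u, v#}) x \<le> count a x" for x
        using ct[of x] c1[of x] c2[of x] z False by (cases "x = z") auto
      then show False using no(1)[OF t(1)] by (meson mset_subset_eqI)
    qed
  next
    fix z t assume t: "t \<in> edge_sums E (Suc j)" "t \<subseteq># s1 \<union># s2"
    have "s1 \<union># s2 \<subseteq># a"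
    proof (rule mset_subset_eqI)
      show "count (s1 \<union># s2) x \<le> count a x" for x
        using c1[of x] c2[of x] by simp
    qed
    then show False using t not_edge_sum_below subset_mset.order_trans by blast
  qed
qed

text \<open>Go to a deficient neighbour of \<open>v\<close> and back.\<close>

lemma jointly_covered_refl: "jointly_covered v v"
  using deficient_neighbour[of v] adjacent_jointly_covered jointly_covered_sym jointly_covered_trans
  by blast

section \<open>Components of deficient vertices\<close>

definition deficient_component :: "'n \<Rightarrow> 'n set" where
  "deficient_component x = {v. (\<lambda>u v. E u v \<and> v \<in> deficient)\<^sup>*\<^sup>* x v}"

lemma deficient_component_step:
  "u \<in> deficient_component x \<Longrightarrow> E u v \<Longrightarrow> v \<in> deficient \<Longrightarrow> v \<in> deficient_component x"
  unfolding deficient_component_def by (auto intro: rtranclp.rtrancl_into_rtrancl)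

text \<open>Adjacent vertices are related, and deficiency of the intermediate vertices of a path
  licenses transitivity.\<close>

lemma deficient_component_covered:
  assumes x: "x \<in> deficient" and v: "v \<in> deficient_component x"
  shows "v \<in> deficient \<and> jointly_covered x v"
proof -
  from v have "(\<lambda>u v. E u v \<and> v \<in> deficient)\<^sup>*\<^sup>* x v" by (simp add: deficient_component_def)
  then show ?thesis
  proof induction
    case base
    then show ?case using x jointly_covered_refl by blast
  next
    case (step u v)
    then show ?case using adjacent_jointly_covered jointly_covered_trans by blast
  qed
qed

text \<open>A maximum matching \<open>M\<close> missing \<open>x\<close> and a matching \<open>N\<close> of degree \<open>deg M + 2x\<close> differ by a closed
  odd trail through \<open>x\<close>. In the induction, \<open>R\<close> and \<open>T\<close> are the parts of \<open>N\<close> and \<open>M\<close> that the trail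
  has not used yet, and the used edges have changed sides.\<close>

lemma alternating_trail_not_bipartite:
  assumes c: "c \<subseteq># a"
    and proper: "\<And>u v. u \<in> deficient_component x \<Longrightarrow> v \<in> deficient_component x \<Longrightarrow> E u v \<Longrightarrow> \<chi> u \<noteq> \<chi> v"
    and "set_mset (m0 + T) \<subseteq> edge_msets E" "size (m0 + T) = j" "add_mset p (\<Sum>\<^sub># (m0 + T)) = c"
    and "set_mset (n0 + R) \<subseteq> edge_msets E" "size (n0 + R) = Suc j" "\<Sum>\<^sub># (n0 + R) = add_mset p c"
    and "\<Sum>\<^sub># R = add_mset x (add_mset p (\<Sum>\<^sub># T))"
    and "p \<in> deficient_component x" and "\<chi> p = (\<chi> x :: bool)"
  shows False
  using assms(3-)
proof (induction "size R" arbitrary: m0 T n0 R p rule: less_induct)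
  case less
  note prems = less.prems
  have deficientI: "q \<in> deficient"
    if "set_mset K \<subseteq> edge_msets E" "size K = j" "add_mset q (\<Sum>\<^sub># K) = c" for q K
    using that edge_sumsI[of K E j] c by (auto simp: deficient_def)
  have "p \<in># \<Sum>\<^sub># R" using prems(7) by simp
  moreover have "set_mset R \<subseteq> edge_msets E" using prems(4) by simp
  ultimately obtain q R' where q: "E p q" and R: "R = add_mset {#p, q#} R'"
    using edge_at_vertex[OF E(1)] by blast
  \<comment> \<open>Removing the edge from \<open>p\<close> to \<open>q\<close> leaves
    \<open>j\<close> edges whose degree is \<open>c\<close> with one \<open>q\<close>
    missing.\<close>
  have "q \<in> deficient"
    using prems(4,5,6) by (intro deficientI[of "n0 + R'"]) (auto simp: R)
  then have qQ: "q \<in> deficient_component x" using prems(8) q deficient_component_step by blast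
  then have \<chi>q: "\<chi> q \<noteq> \<chi> x" using proper q prems(8,9) by metis
  then have "q \<noteq> x" by auto
  have R'T: "add_mset q (\<Sum>\<^sub># R') = add_mset x (\<Sum>\<^sub># T)"
    using prems(7) by (simp add: R add_mset_commute)
  \<comment> \<open>The colour of \<open>q\<close> keeps the trail from closing at \<open>x\<close>
    here, so an edge of \<open>T\<close> must lead on. Since \<open>R\<close> shrinks with each
    round, this cannot go on forever.\<close>
  then have "q \<in># \<Sum>\<^sub># T" using \<open>q \<noteq> x\<close> by (metis insertE set_mset_add_mset_insert insertI1)
  moreover have "set_mset T \<subseteq> edge_msets E" using prems(1) by simp
  ultimately obtain p' T' where p': "E q p'" and T: "T = add_mset {#q, p'#} T'"
    using edge_at_vertex[OF E(1)] by blast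
  let ?m0 = "add_mset {#p, q#} m0" and ?n0 = "add_mset {#q, p'#} n0"
  have m: "set_mset (?m0 + T') \<subseteq> edge_msets E" "size (?m0 + T') = j" "add_mset p' (\<Sum>\<^sub># (?m0 + T')) = c"
    using prems(1-3) edge_msetI[of E, OF q] by (auto simp: T add_mset_commute)
  have n: "set_mset (?n0 + R') \<subseteq> edge_msets E" "size (?n0 + R') = Suc j" "\<Sum>\<^sub># (?n0 + R') = add_mset p' c"
    using prems(4-6) edge_msetI[of E, OF p'] by (auto simp: R add_mset_commute)
  have "p' \<in> deficient_component x"
    using deficientI[OF m] qQ p' deficient_component_step by blast
  moreover have "\<chi> p' = \<chi> x"
    using proper[OF qQ calculation p'] \<chi>q by auto
  moreover have "\<Sum>\<^sub># R' = add_mset x (add_mset p' (\<Sum>\<^sub># T'))"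
    using R'T by (simp add: T add_mset_commute)
  moreover have "size R' < size R" by (simp add: R)
  ultimately show False
    using less.hyps m n by blast
qed

text \<open>The socle condition at \<open>x\<close> gives \<open>j + 1\<close> edges below
  \<open>a\<close> plus \<open>x\<close>. An exchange between such a sum of least excess over
  \<open>s\<close> and \<open>s\<close> itself yields exactly \<open>s\<close> plus twice
  \<open>x\<close>, the second matching needed for the trail.\<close>

lemma deficient_component_not_bipartite:
  assumes x: "x \<in> deficient"
    and proper: "\<And>u v. u \<in> deficient_component x \<Longrightarrow> v \<in> deficient_component x \<Longrightarrow> E u v \<Longrightarrow> \<chi> u \<noteq> (\<chi> v :: bool)"
  shows False
proof -
  obtain s where s: "s \<in> edge_sums E j" and sa: "add_mset x s \<subseteq># a"
    using x by (auto simp: deficient_def)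
  then obtain M where M: "set_mset M \<subseteq> edge_msets E" "size M = j" "s = \<Sum>\<^sub># M"
    by (auto elim: edge_sumsE)
  let ?ok = "\<lambda>t. t \<in> edge_sums E (Suc j) \<and> t \<subseteq># add_mset x a"
  obtain t0 where "?ok t0" using a by (auto simp: socle_degrees_def)
  then obtain t where t: "?ok t" and min: "\<And>t'. ?ok t' \<Longrightarrow> size (t - s) \<le> size (t' - s)"
    using ex_has_least_nat[of ?ok t0 "\<lambda>t. size (t - s)"] by blast
  have "size s < size t" using size_edge_sums[OF s] size_edge_sums[of t E "Suc j"] t by simp
  then have "\<not> t \<subseteq># s" by (meson leD size_mset_mono)
  then obtain v where v: "count s v < count t v"
    by (meson mset_subset_eqI not_less)
  obtain N where N: "set_mset N \<subseteq> edge_msets E" "size N = Suc j" "t = \<Sum>\<^sub># N"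
    using t by (auto elim: edge_sumsE)
  have cs: "count s y + of_bool (y = x) \<le> count a y" for y
    using mset_subset_eq_count[OF sa, of y] by (auto split: if_splits)
  have ct: "count t y \<le> count a y + of_bool (y = x)" for y
    using t mset_subset_eq_count[of t "add_mset x a" y] by (auto split: if_splits)
  have "add_mset x (add_mset x s) \<in> edge_sums E (Suc j)"
    using alternating_exchange[OF E N(1) M(1), folded M(3) N(3), unfolded M(2) N(2), OF v]
  proof (elim disjE exE conjE)
    fix z t' assume z: "count t z < count s z" and t': "t' \<in> edge_sums E (Suc j)" "add_mset v t' = add_mset z t"
    have ct': "count t' y + of_bool (y = v) = count t y + of_bool (y = z)" for y
      using arg_cong[OF t'(2), of "\<lambda>m. count m y"] by (simp split: if_splits)
    have "count t' y \<le> count (add_mset x a) y" for y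
      using ct'[of y] ct[of y] cs[of y] z by (cases "y = z") auto
    then have ok: "?ok t'" using t'(1) by (meson mset_subset_eqI)
    \<comment> \<open>The exchange lowers the excess over \<open>s\<close> at \<open>v\<close> and
      adds none at \<open>z\<close>, against minimality of \<open>t\<close>.\<close>
    have "count (add_mset v (t' - s)) y = count (t - s) y" for y
      using ct'[of y] z v by (cases "y = z"; cases "y = v") auto
    then have "add_mset v (t' - s) = t - s" by (rule multiset_eqI)
    then have "size (t' - s) < size (t - s)" by (metis lessI size_add_mset)
    then show ?thesis using min[OF ok] by simp
  next
    fix z t' assume t': "t' \<in> edge_sums E (Suc j)" "t' = s + {#v, z#}" "t' \<subseteq># t \<union># s"
    \<comment> \<open>\<open>t'\<close> is too large to fit below \<open>a\<close>. The bounds on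
      \<open>t\<close> and \<open>s\<close> allow an overflow only at \<open>x\<close>, and there
      \<open>s\<close> stays two short of it, so both added vertices are \<open>x\<close>.\<close>
    obtain y where y: "count a y < count t' y"
      using not_edge_sum_below[OF t'(1)] by (meson mset_subset_eqI not_less)
    have "count t' y \<le> max (count t y) (count s y)"
      using mset_subset_eq_count[OF t'(3), of y] by simp
    then have "y = x" using y ct[of y] cs[of y] by (cases "y = x") auto
    then have "v = x \<and> z = x" using y cs[of x] by (auto simp: t'(2) split: if_splits)
    then show ?thesis using t'(1,2) by simp
  qed
  then obtain R where R: "set_mset R \<subseteq> edge_msets E" "size R = Suc j" "add_mset x (add_mset x s) = \<Sum>\<^sub># R"
    by (auto elim: edge_sumsE)
  show False
  proof (rule alternating_trail_not_bipartite[where c = "add_mset x s" and x = x and \<chi> = \<chi>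
        and T = M and R = R and p = x and ?m0.0 = "{#}" and ?n0.0 = "{#}"])
    show "\<chi> u \<noteq> \<chi> v"
      if "u \<in> deficient_component x" "v \<in> deficient_component x" "E u v" for u v
      using that by (rule proper)
    show "x \<in> deficient_component x" by (simp add: deficient_component_def)
  qed (use sa M R in simp_all)
qed

end

section \<open>Odd cycles\<close>

text \<open>A shortest odd closed walk is an induced cycle: a repeated vertex or a chord would split it
  into two shorter closed walks, one of them odd.\<close>

lemma odd_closed_walk_induced_cycle:
  assumes E: "symp E" "irreflp E"
    and walk: "((\<lambda>u v. E u v \<and> u \<in> Q \<and> v \<in> Q) ^^ n) y y" "odd n"
  shows "\<exists>c. induced_odd_cycle E c \<and> set c \<subseteq> Q"
proof -
  define G where "G u v \<longleftrightarrow> E u v \<and> u \<in> Q \<and> v \<in> Q" for u v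
  have "\<exists>n. odd n \<and> (\<exists>y. (G ^^ n) y y)"
    using walk unfolding G_def by blast
  then obtain n where n: "odd n" "\<exists>y. (G ^^ n) y y"
    and min: "\<And>m y. m < n \<Longrightarrow> (G ^^ m) y y \<Longrightarrow> even m"
    using exists_least_iff[of "\<lambda>n. odd n \<and> (\<exists>y. (G ^^ n) y y)"] by blast
  obtain f where f: "f n = f 0" and G: "\<And>i. i < n \<Longrightarrow> G (f i) (f (Suc i))"
    using n(2) unfolding relpowp_fun_conv by auto
  have seg: "(G ^^ (l - i)) (f i) (f l)" if "i \<le> l" "l \<le> n" for i l
    unfolding relpowp_fun_conv
    by (rule exI[of _ "\<lambda>m. f (i + m)"]) (use that G in auto)
  have wrap: "(G ^^ (n - l + i)) (f l) (f i)" if "i \<le> l" "l \<le> n" for i l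
    unfolding relpowp_add using seg[of l n] seg[of 0 i] that f by auto
  have irr: "\<not> G u u" and sym: "G u v \<Longrightarrow> G v u" for u v
    using E by (auto simp: G_def dest: irreflpD sympD)
  have "n \<noteq> 1" using irr G[of 0] f by auto
  with n(1) have n3: "3 \<le> n" by presburger
  have inQ: "f i \<in> Q" if "i < n" for i using G[OF that] by (simp add: G_def)
  have dist: "f i \<noteq> f l" if il: "i < l" "l < n" for i l
  proof
    assume eq: "f i = f l"
    have "even (l - i)" "even (n - l + i)"
      using min[of "l - i" "f i"] min[of "n - l + i" "f i"] seg[of i l] wrap[of i l] eq il by auto
    then have "even ((l - i) + (n - l + i))" by simp
    then show False using n(1) il by simp
  qed
  have chord: "l = Suc i \<or> (i = 0 \<and> l = n - 1)" if il: "i < l" "l < n" and e: "E (f i) (f l)" for i l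
  proof (rule ccontr)
    assume no: "\<not> (l = Suc i \<or> (i = 0 \<and> l = n - 1))"
    have g: "G (f i) (f l)" using e inQ il by (simp add: G_def)
    have "(G ^^ Suc (l - i)) (f i) (f i)"
      using seg[of i l] sym[OF g] il by (auto intro: relpowp_Suc_I)
    moreover have "(G ^^ Suc (n - l + i)) (f l) (f l)"
      using wrap[of i l] g il by (auto intro: relpowp_Suc_I)
    ultimately have "even (Suc (l - i))" "even (Suc (n - l + i))"
      using min[of "Suc (l - i)"] min[of "Suc (n - l + i)"] no il by (fastforce)+
    then have "even (Suc (l - i) + Suc (n - l + i))" by simp
    then show False using n(1) il by simp
  qed
  define c where "c = map f [0..<n]"
  have consec: "E (f i) (f (Suc i mod n))" if "i < n" for i
    using G[OF that] f that by (cases "Suc i = n") (auto simp: G_def)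
  have "E (f i) (f l) \<longleftrightarrow> l = Suc i mod n \<or> i = Suc l mod n" if il: "i < n" "l < n" for i l
  proof
    assume e: "E (f i) (f l)"
    then have "i \<noteq> l" using E(2) by (auto dest: irreflpD)
    then consider "i < l" | "l < i" by linarith
    then show "l = Suc i mod n \<or> i = Suc l mod n"
    proof cases
      case 1
      then show ?thesis using chord[OF 1 il(2) e] il by auto
    next
      case 2
      then show ?thesis using chord[OF 2 il(1) sympD[OF E(1) e]] il by auto
    qed
  next
    assume "l = Suc i mod n \<or> i = Suc l mod n"
    then show "E (f i) (f l)" using consec il sympD[OF E(1)] by metis
  qed
  moreover have "distinct c"
    unfolding c_def distinct_map by (auto simp: inj_on_def) (metis dist nat_neq_iff)
  ultimately have "induced_odd_cycle E c"
    using n3 n(1) by (simp add: induced_odd_cycle_def induced_cycle_def c_def)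
  moreover have "set c \<subseteq> Q" using inQ by (auto simp: c_def)
  ultimately show ?thesis by blast
qed

lemma relpowp_symp:
  assumes "symp R" "(R ^^ n) x y"
  shows "(R ^^ n) y x"
  using assms(2)
proof (induction n arbitrary: y)
  case (Suc n)
  then obtain z where "(R ^^ n) x z" "R z y" by auto
  then show ?case using Suc.IH assms(1) by (metis relpowp_Suc_I2 sympD)
qed auto

text \<open>Colour a vertex by whether an even walk from \<open>x\<close> reaches it. An edge with
  equally coloured ends then closes an odd walk.\<close>

lemma not_bipartite_odd_cycle:
  assumes E: "symp E" "irreflp E"
    and conn: "\<And>v. v \<in> Q \<Longrightarrow> (\<lambda>u v. E u v \<and> u \<in> Q \<and> v \<in> Q)\<^sup>*\<^sup>* x v"
    and no_col: "\<And>\<chi> :: 'n \<Rightarrow> bool. \<exists>u \<in> Q. \<exists>v \<in> Q. E u v \<and> \<chi> u = \<chi> v"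
  shows "\<exists>c. induced_odd_cycle E c \<and> set c \<subseteq> Q"
proof -
  define G where "G u v \<longleftrightarrow> E u v \<and> u \<in> Q \<and> v \<in> Q" for u v
  have G: "symp G" using E(1) by (auto simp: G_def symp_def)
  obtain u v where uv: "u \<in> Q" "v \<in> Q" "E u v"
    and col: "(\<exists>n. even n \<and> (G ^^ n) x u) = (\<exists>n. even n \<and> (G ^^ n) x v)"
    using no_col[of "\<lambda>u. \<exists>n. even n \<and> (G ^^ n) x u"] by blast
  have Guv: "G u v" using uv by (simp add: G_def)
  have "\<exists>n y. odd n \<and> (G ^^ n) y y"
  proof (cases "\<exists>n. even n \<and> (G ^^ n) x u")
    case True
    then obtain n m where nm: "even n" "(G ^^ n) x u" "even m" "(G ^^ m) x v" using col by blast
    then have "(G ^^ Suc n) x v" using Guv by (auto intro: relpowp_Suc_I)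
    moreover have "(G ^^ m) v x" using nm G by (simp add: relpowp_symp)
    ultimately have "(G ^^ (Suc n + m)) x x" unfolding relpowp_add by blast
    then show ?thesis using nm by (intro exI[of _ "Suc n + m"]) auto
  next
    \<comment> \<open>This case is contradictory: an odd walk reaches \<open>u\<close>, and one more
      step makes an even walk to \<open>v\<close>.\<close>
    case False
    have "G\<^sup>*\<^sup>* x u" using conn[OF uv(1)] by (simp add: G_def[abs_def])
    then obtain n where n: "(G ^^ n) x u" by (auto dest: rtranclp_imp_relpowp)
    then have "odd n" using False by blast
    moreover have "(G ^^ Suc n) x v" using n Guv by (auto intro: relpowp_Suc_I)
    ultimately have "\<exists>n. even n \<and> (G ^^ n) x v" by (metis even_Suc)
    then show ?thesis using False col by blast
  qed
  then show ?thesis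
    using odd_closed_walk_induced_cycle[OF E] unfolding G_def[abs_def] by blast
qed

section \<open>Socle degrees under the odd cycle condition\<close>

lemma deficient_odd_cycle:
  assumes E: "symp E" "irreflp E" and a: "a \<in> socle_degrees E (Suc j)"
    and x: "x \<in> deficient E a j"
  shows "\<exists>c. induced_odd_cycle E c \<and> set c \<subseteq> deficient_component E a j x"
proof (rule not_bipartite_odd_cycle[OF E])
  let ?Q = "deficient_component E a j x"
  fix v assume "v \<in> ?Q"
  then have "(\<lambda>u v. E u v \<and> v \<in> deficient E a j)\<^sup>*\<^sup>* x v"
    by (simp add: deficient_component_def[OF E a])
  then have "(\<lambda>u v. E u v \<and> u \<in> ?Q \<and> v \<in> ?Q)\<^sup>*\<^sup>* x v \<and> v \<in> ?Q"
  proof induction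
    case base
    then show ?case by (simp add: deficient_component_def[OF E a])
  next
    case (step u v)
    then show ?case
      using deficient_component_step[OF E a] by (auto intro: rtranclp.rtrancl_into_rtrancl)
  qed
  then show "(\<lambda>u v. E u v \<and> u \<in> ?Q \<and> v \<in> ?Q)\<^sup>*\<^sup>* x v" by blast
next
  fix \<chi> :: "'a \<Rightarrow> bool"
  show "\<exists>u \<in> deficient_component E a j x. \<exists>v \<in> deficient_component E a j x. E u v \<and> \<chi> u = \<chi> v"
    using deficient_component_not_bipartite[OF E a x, of \<chi>] by blast
qed

lemma socle_degree_size:
  assumes E: "symp E" "irreflp E"
    and odd: "\<And>c d. induced_odd_cycle E c \<Longrightarrow> induced_odd_cycle E d \<Longrightarrow> distance_at_most_one E c d"
    and a: "a \<in> socle_degrees E (Suc j)"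
  shows "size a = 2 * j + 1"
proof (rule antisym)
  note jc_sym = jointly_covered_sym[OF E a] and jc_trans = jointly_covered_trans[OF E a]
  show "size a \<le> 2 * j + 1"
  proof (rule ccontr)
    assume large: "\<not> size a \<le> 2 * j + 1"
    obtain w s where s: "s \<in> edge_sums E j" "add_mset w s \<subseteq># a"
      using deficient_neighbour[OF E a] unfolding deficient_def[OF E a] by blast
    have sa: "s \<subseteq># a" using s(2) by (metis mset_subset_eq_insertD subset_mset.less_imp_le)
    have "size (a - s) \<ge> 2"
      using large size_edge_sums[OF s(1)] by (simp add: size_Diff_submset[OF sa])
    then obtain n where "size (a - s) = Suc (Suc n)"
      by (metis add_2_eq_Suc le_iff_add)
    then obtain x K1 where "a - s = add_mset x K1" "size K1 = Suc n"
      by (metis size_eq_Suc_imp_eq_union size_add_mset Suc_inject)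
    moreover from this(2) obtain y K where "K1 = add_mset y K"
      by (metis size_eq_Suc_imp_eq_union)
    ultimately have "a = s + {#x, y#} + K"
      using subset_mset.add_diff_inverse[OF sa] by simp
    then have axy: "s + {#x, y#} \<subseteq># a" by (simp only: mset_subset_eq_add_left)
    then have nxy: "\<not> jointly_covered E a j x y"
      using s(1) by (auto simp: jointly_covered_def[OF E a])
    have "add_mset x s \<subseteq># s + {#x, y#}" "add_mset y s \<subseteq># s + {#x, y#}" by auto
    then have "add_mset x s \<subseteq># a" "add_mset y s \<subseteq># a"
      using axy subset_mset.order_trans by blast+
    then have xy: "x \<in> deficient E a j" "y \<in> deficient E a j"
      using s(1) unfolding deficient_def[OF E a] by blast+
    obtain c d where c: "induced_odd_cycle E c" "set c \<subseteq> deficient_component E a j x"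
      and d: "induced_odd_cycle E d" "set d \<subseteq> deficient_component E a j y"
      using deficient_odd_cycle[OF E a] xy by metis
    have cov: "u \<in> deficient E a j \<and> jointly_covered E a j x u" if "u \<in> set c" for u
      using deficient_component_covered[OF E a xy(1)] c(2) that by blast
    have dov: "u \<in> deficient E a j \<and> jointly_covered E a j y u" if "u \<in> set d" for u
      using deficient_component_covered[OF E a xy(2)] d(2) that by blast
    from odd[OF c(1) d(1)] show False
      unfolding distance_at_most_one_def
    proof (elim disjE bexE)
      fix u v assume u: "u \<in> set c" and v: "v \<in> set d" and "E u v"
      from \<open>E u v\<close> have "jointly_covered E a j u v" by (rule adjacent_jointly_covered[OF E a])
      then have "jointly_covered E a j x v"
        by (rule jc_trans[OF conjunct1[OF cov[OF u]] conjunct2[OF cov[OF u]]])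
      then have "jointly_covered E a j x y"
        by (rule jc_trans[OF conjunct1[OF dov[OF v]] _ jc_sym[OF conjunct2[OF dov[OF v]]]])
      with nxy show False by contradiction
    next
      assume "set c \<inter> set d \<noteq> {}"
      then obtain v where v: "v \<in> set c" "v \<in> set d" by blast
      have "jointly_covered E a j x y"
        by (rule jc_trans[OF conjunct1[OF cov[OF v(1)]] conjunct2[OF cov[OF v(1)]]
              jc_sym[OF conjunct2[OF dov[OF v(2)]]]])
      with nxy show False by contradiction
    qed
  qed
  \<comment> \<open>Any vertex will do for the lower bound, so \<open>undefined\<close> is taken:
    \<open>2 (j + 1) \<le> size a + 1\<close>.\<close>
  obtain s where "s \<in> edge_sums E (Suc j)" "s \<subseteq># add_mset undefined a"
    using a by (auto simp: socle_degrees_def)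
  then show "2 * j + 1 \<le> size a"
    using size_edge_sums size_mset_mono by fastforce
qed

lemma socle_degrees_0: "socle_degrees E 0 = {}"
  by (auto simp: socle_degrees_def edge_sums_0)

text \<open>By \<open>socle_degree_size\<close> the new size is \<open>2 (k + 1) - 1\<close>, too
  small for \<open>k + 1\<close> edges. This is the only way in which the odd cycle condition
  enters.\<close>

lemma socle_degrees_add_edge:
  assumes E: "symp E" "irreflp E"
    and odd: "\<And>c d. induced_odd_cycle E c \<Longrightarrow> induced_odd_cycle E d \<Longrightarrow> distance_at_most_one E c d"
    and a: "a \<in> socle_degrees E k" and e: "e \<in> edge_msets E"
  shows "e + a \<in> socle_degrees E (Suc k)"
proof -
  obtain j where k: "k = Suc j" using a socle_degrees_0 by (cases k) auto
  have "size (e + a) = 2 * Suc k - 1"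
    using socle_degree_size[OF E odd] a e by (auto simp: k edge_msets_def)
  then have "\<not> s \<subseteq># e + a" if "s \<in> edge_sums E (Suc k)" for s
    using size_edge_sums[OF that] size_mset_mono[of s "e + a"] by auto
  moreover have "\<exists>s \<in> edge_sums E (Suc k). s \<subseteq># add_mset v (e + a)" for v
  proof -
    obtain s where s: "s \<in> edge_sums E k" "s \<subseteq># add_mset v a"
      using a by (auto simp: socle_degrees_def)
    have "e + s \<in> edge_sums E (Suc k)" using e s(1) unfolding edge_sums_Suc by blast
    moreover have "e + s \<subseteq># add_mset v (e + a)"
      using s(2) by (metis subset_mset.add_left_mono union_mset_add_mset_right)
    ultimately show ?thesis by blast
  qed
  ultimately show ?thesis by (simp add: socle_degrees_def)
qed

lemma socle_degrees_add_edges: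
  assumes E: "symp E" "irreflp E"
    and odd: "\<And>c d. induced_odd_cycle E c \<Longrightarrow> induced_odd_cycle E d \<Longrightarrow> distance_at_most_one E c d"
    and a: "a \<in> socle_degrees E k" and L: "set_mset L \<subseteq> edge_msets E"
  shows "\<Sum>\<^sub># L + a \<in> socle_degrees E (size L + k)"
  using L
proof (induction L)
  case (add e L)
  then show ?case
    using socle_degrees_add_edge[OF E odd, of "\<Sum>\<^sub># L + a" "size L + k" e] by (simp add: add.assoc)
qed (simp add: a)

section \<open>Dickson's lemma and stabilization\<close>

lemma nat_mono_subseq:
  fixes s :: "nat \<Rightarrow> nat"
  shows "\<exists>r :: nat \<Rightarrow> nat. strict_mono r \<and> mono (\<lambda>i. s (r i))"
proof -
  obtain r where r: "strict_mono r" "monoseq (\<lambda>i. s (r i))" using seq_monosub by blast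
  show ?thesis
  proof (cases "\<forall>m. \<forall>n\<ge>m. s (r m) \<le> s (r n)")
    case True
    then have "mono (\<lambda>i. s (r i))" by (simp add: mono_def)
    then show ?thesis using r(1) by blast
  next
    case False
    then have dec: "s (r n) \<le> s (r m)" if "m \<le> n" for m n
      using r(2) that unfolding monoseq_def by blast
    \<comment> \<open>A nonincreasing sequence of naturals is constant once it attains its minimum,
      so its tail is also nondecreasing.\<close>
    obtain N where N: "\<And>n. s (r N) \<le> s (r n)"
      using ex_has_least_nat[of "\<lambda>_. True" 0 "\<lambda>n. s (r n)"] by auto
    then have "s (r (N + i)) = s (r N)" for i by (meson antisym dec le_add1)
    then show ?thesis
      using r(1) by (intro exI[of _ "\<lambda>i. r (N + i)"]) (auto simp: strict_mono_def mono_def)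
  qed
qed

text \<open>Pass to a subsequence for one element of \<open>A\<close> after another; in the end all
  multiplicities are nondecreasing at once.\<close>

lemma dickson:
  fixes f :: "nat \<Rightarrow> 'a multiset"
  assumes "finite A" "\<And>i. set_mset (f i) \<subseteq> A"
  shows "\<exists>i l. i < l \<and> f i \<subseteq># f l"
proof -
  have "\<exists>r :: nat \<Rightarrow> nat. strict_mono r \<and> (\<forall>x\<in>B. mono (\<lambda>i. count (f (r i)) x))" if "finite B" for B
    using that
  proof induction
    case empty
    have "strict_mono (\<lambda>i :: nat. i)" by (simp add: strict_mono_def)
    then show ?case by blast
  next
    case (insert x B)
    then obtain r :: "nat \<Rightarrow> nat" where r: "strict_mono r" "\<forall>x\<in>B. mono (\<lambda>i. count (f (r i)) x)" by blast
    obtain q :: "nat \<Rightarrow> nat" where q: "strict_mono q" "mono (\<lambda>i. count (f (r (q i))) x)"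
      using nat_mono_subseq[of "\<lambda>i. count (f (r i)) x"] by blast
    have "mono q" using q(1) by (rule strict_mono_mono)
    then have "\<forall>y\<in>insert x B. mono (\<lambda>i. count (f (r (q i))) y)"
      using r(2) q(2) by (auto simp: mono_def)
    then show ?case
      using r(1) q(1) by (intro exI[of _ "\<lambda>i. r (q i)"]) (auto simp: strict_mono_def)
  qed
  then obtain r :: "nat \<Rightarrow> nat" where r: "strict_mono r" "\<forall>x\<in>A. mono (\<lambda>i. count (f (r i)) x)" using assms(1) by blast
  have "f (r 0) \<subseteq># f (r 1)"
  proof (rule mset_subset_eqI)
    fix x
    show "count (f (r 0)) x \<le> count (f (r 1)) x"
    proof (cases "x \<in> A")
      case True
      then show ?thesis using r(2) by (auto simp: mono_def)
    next
      case False
      then have "x \<notin># f (r 0)" using assms(2) by blast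
      then show ?thesis by (simp add: not_in_iff)
    qed
  qed
  moreover have "r 0 < r 1" using r(1) by (simp add: strict_mono_def)
  ultimately show ?thesis by blast
qed

text \<open>A socle degree of \<open>S/I(G)\<^sup>k\<close> plus a vertex is a sum of \<open>k\<close> edges, and Dickson's lemma
  applies to these edge multisets.\<close>

lemma socle_degrees_stable:
  fixes E :: "'n::finite \<Rightarrow> 'n \<Rightarrow> bool"
  assumes E: "symp E" "irreflp E"
    and odd: "\<And>c d. induced_odd_cycle E c \<Longrightarrow> induced_odd_cycle E d \<Longrightarrow> distance_at_most_one E c d"
  shows "\<exists>k0. \<forall>k\<ge>k0. socle_degrees E (Suc k) = {e + a | e a. e \<in> edge_msets E \<and> a \<in> socle_degrees E k}"
proof (rule ccontr)
  define good where "good k = {e + a | e a. e \<in> edge_msets E \<and> a \<in> socle_degrees E k}" for k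
  assume "\<not> ?thesis"
  moreover have "good k \<subseteq> socle_degrees E (Suc k)" for k
    using socle_degrees_add_edge[OF E odd] by (auto simp: good_def)
  ultimately have "\<forall>k0. \<exists>k\<ge>k0. \<exists>a. a \<in> socle_degrees E (Suc k) - good k"
    unfolding good_def[symmetric] by blast
  then have "infinite {k. \<exists>a. a \<in> socle_degrees E (Suc k) - good k}"
    by (simp add: infinite_nat_iff_unbounded_le)
  from infinite_enumerate[OF this] obtain r :: "nat \<Rightarrow> nat"
    where r: "strict_mono r" "\<forall>i. \<exists>a. a \<in> socle_degrees E (Suc (r i)) - good (r i)"
    by auto
  from choice[OF r(2)] obtain a
    where a: "\<And>i. a i \<in> socle_degrees E (Suc (r i))" "\<And>i. a i \<notin> good (r i)"
    by auto
  \<comment> \<open>One vertex for the whole sequence, so that it cancels when two terms are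
    compared.\<close>
  fix v :: 'n
  have "\<exists>M. set_mset M \<subseteq> edge_msets E \<and> size M = Suc (r i) \<and> \<Sum>\<^sub># M = add_mset v (a i)" for i
  proof -
    obtain s where s: "s \<in> edge_sums E (Suc (r i))" "s \<subseteq># add_mset v (a i)"
      using a(1)[of i] unfolding socle_degrees_def by blast
    \<comment> \<open>Both sizes are \<open>2 (r i + 1)\<close>, so the edge sum below exhausts
      \<open>add_mset v (a i)\<close>.\<close>
    have "size (add_mset v (a i)) = size s"
      using socle_degree_size[OF E odd a(1)] size_edge_sums[OF s(1)] by simp
    then have "s = add_mset v (a i)"
      using s(2) by (metis mset_subset_size nat_less_le subset_mset.le_imp_less_or_eq)
    then show ?thesis using s(1) by (metis edge_sumsE)
  qed
  then obtain M where M: "\<And>i. set_mset (M i) \<subseteq> edge_msets E" "\<And>i. size (M i) = Suc (r i)"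
      "\<And>i. \<Sum>\<^sub># (M i) = add_mset v (a i)"
    by metis
  have "edge_msets E \<subseteq> (\<lambda>(u, v). {#u, v#}) ` UNIV" by (auto simp: edge_msets_def)
  then have "finite (edge_msets E)" by (rule finite_subset) simp
  then obtain i l where il: "i < l" "M i \<subseteq># M l"
    using dickson M(1) by metis
  then obtain L where L: "M l = L + M i" by (metis subset_mset.diff_add)
  \<comment> \<open>The edge multisets have different sizes, so at least one edge can be split off;
    the remaining ones lead from \<open>a i\<close> to a socle degree for \<open>r l\<close>,
    against the choice of \<open>a l\<close>.\<close>
  have "r i < r l" using r(1) il(1) by (simp add: strict_mono_def)
  then have "size L \<noteq> 0" using M(2) L by (metis add_0 nat_neq_iff size_union Suc_inject)
  then obtain e L' where e: "L = add_mset e L'" by (metis multiset_nonemptyE multi_member_split size_empty)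
  have edges: "e \<in> edge_msets E" "set_mset L' \<subseteq> edge_msets E"
    using M(1)[of l] by (auto simp: L e)
  have "size L' + Suc (r i) = r l" using M(2)[of l] M(2)[of i] by (simp add: L e)
  then have "\<Sum>\<^sub># L' + a i \<in> socle_degrees E (r l)"
    using socle_degrees_add_edges[OF E odd a(1) edges(2)] by metis
  moreover have "a l = e + (\<Sum>\<^sub># L' + a i)"
    using M(3)[of l] M(3)[of i] by (simp add: L e add.assoc)
  ultimately show False
    using a(2)[of l] edges(1) by (auto simp: good_def)
qed

section \<open>Monomial ideals\<close>

text \<open>Bridge between the exponent vectors of \<open>mpoly\<close> and the multisets of
  vertices used in the combinatorial part.\<close>

definition exponent :: "'n::finite multiset \<Rightarrow> 'n \<Rightarrow>\<^sub>0 nat" where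
  "exponent A = Abs_poly_mapping (count A)"

lemma lookup_exponent [simp]: "lookup (exponent A) v = count A v"
  by (simp add: exponent_def)

lemma exponent_surj: "\<exists>A. exponent A = m"
proof -
  have "exponent (Abs_multiset (lookup m)) = m"
    by (rule poly_mapping_eqI) (simp add: count_Abs_multiset)
  then show ?thesis ..
qed

lemma exponent_add: "exponent (A + B) = exponent A + exponent B"
  by (rule poly_mapping_eqI) (simp add: lookup_add)

definition monom_of :: "'n::finite multiset \<Rightarrow> ('n, 'k::comm_ring_1) mpoly" where
  "monom_of A = xmonom (exponent A)"

lemma monom_of_add: "monom_of (A + B) = (monom_of A * monom_of B :: ('n::finite, 'k::comm_ring_1) mpoly)"
  by (simp add: monom_of_def xmonom_def exponent_add mult_single)

lemma monom_of_empty [simp]: "monom_of {#} = 1"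
proof -
  have "exponent ({#} :: 'a multiset) = 0" by (rule poly_mapping_eqI) simp
  then show ?thesis by (simp add: monom_of_def xmonom_def)
qed

lemma monom_of_add_mset: "monom_of (add_mset v A) = xvar v * monom_of A"
proof -
  have "exponent (add_mset v A) = single v 1 + exponent A"
    by (rule poly_mapping_eqI) (simp add: lookup_add lookup_single when_def)
  then show ?thesis by (simp add: monom_of_def xvar_def xmonom_def mult_single)
qed

lemma is_ideal_ideal_gen [simp]: "is_ideal (ideal_gen A)"
  by (simp add: ideal_gen_def)

lemma ideal_gen_superset: "a \<in> A \<Longrightarrow> a \<in> ideal_gen A"
  by (simp add: ideal_gen_def ring_mod.span_base)

lemma ideal_gen_minimal: "A \<subseteq> J \<Longrightarrow> is_ideal J \<Longrightarrow> ideal_gen A \<subseteq> J"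
  unfolding ideal_gen_def by (rule ring_mod.span_minimal)

text \<open>For a fixed factor, the elements whose product with it lies in an ideal form an ideal.
  This is used twice, first for a generator \<open>a\<close> and then for an arbitrary
  \<open>g\<close>.\<close>

lemma ideal_mult_gen:
  "ideal_mult (ideal_gen A) (ideal_gen B) = ideal_gen {a * b | a b. a \<in> A \<and> b \<in> B}"
proof
  let ?J = "ideal_gen {a * b | a b. a \<in> A \<and> b \<in> B}"
  have 1: "a * g \<in> ?J" if "a \<in> A" "g \<in> ideal_gen B" for a g
  proof -
    have "is_ideal {g. a * g \<in> ?J}"
      unfolding ring_mod.subspace_def
      by (auto simp: distrib_left mult.left_commute[of a] ring_mod.subspace_0 ring_mod.subspace_add
          ring_mod.subspace_scale simp del: ring_mod.scale_scale)
    moreover have "B \<subseteq> {g. a * g \<in> ?J}"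
      using that(1) by (auto intro!: ideal_gen_superset)
    ultimately show ?thesis using ideal_gen_minimal that(2) by blast
  qed
  have 2: "f * g \<in> ?J" if "f \<in> ideal_gen A" "g \<in> ideal_gen B" for f g
  proof -
    have "is_ideal {f. f * g \<in> ?J}"
      unfolding ring_mod.subspace_def
      by (auto simp: distrib_right mult.assoc ring_mod.subspace_0 ring_mod.subspace_add
          ring_mod.subspace_scale simp del: ring_mod.scale_scale)
    moreover have "A \<subseteq> {f. f * g \<in> ?J}"
      using 1 that(2) by auto
    ultimately show ?thesis using ideal_gen_minimal that(1) by blast
  qed
  show "ideal_mult (ideal_gen A) (ideal_gen B) \<subseteq> ?J"
    unfolding ideal_mult_def by (rule ideal_gen_minimal) (use 2 in auto)
  show "?J \<subseteq> ideal_mult (ideal_gen A) (ideal_gen B)"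
    unfolding ideal_mult_def
    by (rule ideal_gen_minimal) (auto intro!: ideal_gen_superset)
qed

lemma ideal_mult_monomial:
  "ideal_mult (ideal_gen (monom_of ` A)) (ideal_gen (monom_of ` B) :: ('n::finite, 'k::comm_ring_1) mpoly set)
     = ideal_gen (monom_of ` {a + b | a b. a \<in> A \<and> b \<in> B})"
proof -
  have "{f * g | f g. f \<in> monom_of ` A \<and> g \<in> monom_of ` B}
      = (monom_of ` {a + b | a b. a \<in> A \<and> b \<in> B} :: ('n, 'k) mpoly set)"
  proof (intro set_eqI iffI)
    fix x assume "x \<in> {f * g | f g. f \<in> monom_of ` A \<and> g \<in> (monom_of ` B :: ('n, 'k) mpoly set)}"
    then obtain a b where "a \<in> A" "b \<in> B" "x = monom_of (a + b)"
      by (auto simp: monom_of_add)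
    then show "x \<in> monom_of ` {a + b | a b. a \<in> A \<and> b \<in> B}" by blast
  next
    fix x :: "('n, 'k) mpoly" assume "x \<in> monom_of ` {a + b | a b. a \<in> A \<and> b \<in> B}"
    then obtain a b where "a \<in> A" "b \<in> B" "x = monom_of a * monom_of b"
      by (auto simp: monom_of_add)
    then show "x \<in> {f * g | f g. f \<in> monom_of ` A \<and> g \<in> monom_of ` B}" by blast
  qed
  then show ?thesis by (simp add: ideal_mult_gen)
qed

lemma monom_of_mem_ideal_gen:
  "(monom_of a :: ('n::finite, 'k::comm_ring_1) mpoly) \<in> ideal_gen (monom_of ` S) \<longleftrightarrow> (\<exists>s\<in>S. s \<subseteq># a)"
proof
  assume mem: "(monom_of a :: ('n, 'k) mpoly) \<in> ideal_gen (monom_of ` S)"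
  \<comment> \<open>Polynomials all of whose monomials are divisible by some generator; they form an
    ideal that contains the generators.\<close>
  let ?J = "{p :: ('n, 'k) mpoly. \<forall>m\<in>keys p. \<exists>s\<in>S. \<forall>v. count s v \<le> lookup m v}"
  have "is_ideal ?J"
  proof (rule ring_mod.subspaceI)
    fix p q assume "p \<in> ?J" "q \<in> ?J"
    then show "p + q \<in> ?J" using Poly_Mapping.keys_add[of p q] by blast
  next
    fix r p assume p: "p \<in> ?J"
    show "r * p \<in> ?J"
    proof (intro CollectI ballI)
      fix m assume "m \<in> keys (r * p)"
      then obtain m1 m2 where m: "m = m1 + m2" "m2 \<in> keys p" using keys_mult[of r p] by blast
      then obtain s where "s \<in> S" "\<forall>v. count s v \<le> lookup m2 v" using p by blast
      then show "\<exists>s\<in>S. \<forall>v. count s v \<le> lookup m v"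
        by (intro bexI[of _ s]) (auto simp: m(1) lookup_add trans_le_add2)
    qed
  qed simp
  moreover have "monom_of ` S \<subseteq> ?J"
    by (auto simp: monom_of_def xmonom_def)
  ultimately have "monom_of a \<in> ?J" using mem ideal_gen_minimal by blast
  then obtain s where "s \<in> S" "\<forall>v. count s v \<le> count a v"
    by (auto simp: monom_of_def xmonom_def)
  then show "\<exists>s\<in>S. s \<subseteq># a" by (auto intro: mset_subset_eqI)
next
  assume "\<exists>s\<in>S. s \<subseteq># a"
  then obtain s b where s: "s \<in> S" "a = b + s" by (metis subset_mset.diff_add)
  then have "(monom_of s :: ('n, 'k) mpoly) \<in> ideal_gen (monom_of ` S)"
    by (intro ideal_gen_superset) simp
  then show "(monom_of a :: ('n, 'k) mpoly) \<in> ideal_gen (monom_of ` S)"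
    unfolding s(2) monom_of_add by (rule ideal_mult_right[OF is_ideal_ideal_gen])
qed

lemma edge_ideal_monomial:
  "edge_ideal E = ideal_gen (monom_of ` edge_msets E :: ('n::finite, 'k::comm_ring_1) mpoly set)"
proof -
  have "xvar u * xvar v = (monom_of {#u, v#} :: ('n, 'k) mpoly)" for u v :: 'n
    by (simp add: monom_of_add_mset)
  then have "{xvar u * xvar v | u v. E u v} = (monom_of ` edge_msets E :: ('n, 'k) mpoly set)"
    unfolding edge_msets_def by (simp only:) blast
  then show ?thesis by (simp add: edge_ideal_def)
qed

lemma edge_ideal_power_monomial:
  "ideal_power (edge_ideal E) k = ideal_gen (monom_of ` edge_sums E k :: ('n::finite, 'k::comm_ring_1) mpoly set)"
proof (induction k)
  case 0
  have "x \<in> ideal_gen {1}" for x :: "('n, 'k) mpoly"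
    using ideal_mult_right[OF is_ideal_ideal_gen ideal_gen_superset[of 1 "{1}"], of x] by simp
  then show ?case by (auto simp: edge_sums_0)
next
  case (Suc k)
  then show ?case
    by (simp only: ideal_power.simps edge_ideal_monomial ideal_mult_monomial edge_sums_Suc)
qed

section \<open>Homological shift ideals of powers of edge ideals\<close>

text \<open>The shift by \<open>mset_set UNIV\<close> is the degree (1, ..., 1) of the top Koszul
  basis element. \<open>k > 0\<close> makes the power a proper ideal, as
  \<open>Tor_nonzero_top_iff\<close> requires.\<close>

lemma HS_edge_ideal_power:
  fixes E :: "'n::finite \<Rightarrow> 'n \<Rightarrow> bool"
  assumes "k > 0"
  shows "HS (CARD('n) - 1) (ideal_power (edge_ideal E :: ('n, 'k::field) mpoly set) k)
    = ideal_gen (monom_of ` (\<lambda>a. a + mset_set UNIV) ` socle_degrees E k)"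
proof -
  let ?J = "ideal_power (edge_ideal E :: ('n, 'k) mpoly set) k"
  have ideal: "is_ideal ?J" by (simp add: edge_ideal_power_monomial)
  have mem: "monom_of a \<in> ?J \<longleftrightarrow> (\<exists>s\<in>edge_sums E k. s \<subseteq># a)" for a
    by (simp add: edge_ideal_power_monomial monom_of_mem_ideal_gen)
  have proper: "1 \<notin> ?J"
  proof
    assume "1 \<in> ?J"
    then obtain s where "s \<in> edge_sums E k" "s \<subseteq># {#}"
      using mem[of "{#}"] by auto
    then show False using size_edge_sums[of s E k] assms by simp
  qed
  have socle: "Tor_nonzero (CARD('n) - 1) ?J (\<lambda>v. int (lookup b v)) \<longleftrightarrow>
      (\<exists>a \<in> socle_degrees E k. b = exponent (a + mset_set UNIV))" for b
  proof -
    have xv: "xvar v * xmonom (exponent a) = (monom_of (add_mset v a) :: ('n, 'k) mpoly)" for v a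
      by (simp add: monom_of_add_mset flip: monom_of_def)
    have deg: "(\<lambda>v. int (lookup b v)) = (\<lambda>v. int (lookup (exponent a) v) + 1) \<longleftrightarrow>
        b = exponent (a + mset_set UNIV)" for a
      by (auto simp: fun_eq_iff poly_mapping_eq_iff) (metis of_nat_eq_iff of_nat_Suc add.commute)+
    have "a \<in> socle_degrees E k \<longleftrightarrow> xmonom (exponent a) \<notin> ?J \<and> (\<forall>v. xvar v * xmonom (exponent a) \<in> ?J)" for a
      unfolding xv using mem[of a] mem by (simp add: socle_degrees_def monom_of_def)
    then show ?thesis
      unfolding Tor_nonzero_top_iff[OF ideal proper] using deg exponent_surj by metis
  qed
  have "{xmonom a | a. Tor_nonzero (CARD('n) - 1) ?J (\<lambda>v. int (lookup a v))}
      = (monom_of ` (\<lambda>a. a + mset_set UNIV) ` socle_degrees E k :: ('n, 'k) mpoly set)"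
    unfolding socle by (auto simp: monom_of_def)
  then show ?thesis by (simp add: HS_def)
qed

theorem corollary1p6:
  fixes E :: "'n::finite \<Rightarrow> 'n \<Rightarrow> bool"
  assumes "simple_graph E"
    and "connected_graph E"
    and "\<And>c d. induced_odd_cycle E c \<Longrightarrow> induced_odd_cycle E d \<Longrightarrow> distance_at_most_one E c d"
  shows "\<exists>k0. \<forall>k \<ge> k0.
    HS (CARD('n) - 1) (ideal_power (edge_ideal E :: ('n, 'k::field) mpoly set) (k + 1)) =
      ideal_mult (edge_ideal E) (HS (CARD('n) - 1) (ideal_power (edge_ideal E) k))"
proof -
  have E: "symp E" "irreflp E" using assms(1) by (auto simp: simple_graph_def)
  obtain k0 where k0: "\<And>k. k \<ge> k0 \<Longrightarrow>
      socle_degrees E (Suc k) = {e + a | e a. e \<in> edge_msets E \<and> a \<in> socle_degrees E k}"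
    using socle_degrees_stable[OF E assms(3)] by blast
  \<comment> \<open>The bound is \<open>Suc k0\<close> and not \<open>k0\<close> so that
    \<open>k > 0\<close> and \<open>HS_edge_ideal_power\<close> applies to \<open>k\<close>
    itself.\<close>
  have "HS (CARD('n) - 1) (ideal_power (edge_ideal E :: ('n, 'k) mpoly set) (k + 1)) =
      ideal_mult (edge_ideal E) (HS (CARD('n) - 1) (ideal_power (edge_ideal E) k))"
    if "k \<ge> Suc k0" for k
  proof -
    let ?shift = "\<lambda>a. a + mset_set UNIV"
    have "?shift ` socle_degrees E (Suc k)
        = {e + b | e b. e \<in> edge_msets E \<and> b \<in> ?shift ` socle_degrees E k}"
      using k0[of k] that by (auto simp: image_iff add.assoc) (metis add.assoc)+
    then have "HS (CARD('n) - 1) (ideal_power (edge_ideal E) (k + 1))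
        = ideal_gen (monom_of ` {e + b | e b. e \<in> edge_msets E \<and> b \<in> ?shift ` socle_degrees E k}
            :: ('n, 'k) mpoly set)"
      using HS_edge_ideal_power[of "k + 1" E, where 'k = 'k] by simp
    also have "\<dots> = ideal_mult (edge_ideal E) (ideal_gen (monom_of ` ?shift ` socle_degrees E k))"
      by (simp only: edge_ideal_monomial ideal_mult_monomial)
    also have "\<dots> = ideal_mult (edge_ideal E) (HS (CARD('n) - 1) (ideal_power (edge_ideal E) k))"
      using HS_edge_ideal_power[of k E, where 'k = 'k] that by simp
    finally show ?thesis .
  qed
  then show ?thesis by blast
qed

end
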